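(* Let $\mathfrak{L}$ be a completely distributive commutative subspace lattice on a complex separable Hilbert space $\mathcal{H}$ and let $\Phi:\operatorname{Alg}\mathfrak{L}\to\operatorname{Alg}\mathfrak{L}$ be a weakly continuous rank preserving map. Let $$M_i=\vee\{E\in\mathfrak{L}: E\text{ is isolated}\},$$ $$M_c=\vee\{E\in\mathfrak{L}: E\text{ is consistent with respect to }\Phi\}\ominus M_i,$$ $$M_t=\vee\{E\in\mathfrak{L}: E\text{ is twisted with respect to }\Phi\}\ominus M_i.$$ Then $$\operatorname{Alg}\mathfrak{L}=\operatorname{Alg}(M_i\mathfrak{L}M_i)\oplus\operatorname{Alg}(M_c\mathfrak{L}M_c)\oplus\operatorname{Alg}(M_t\mathfrak{L}M_t).$$
   Context: Subspaces of $\mathcal{H}$ are identified with the orthogonal projections onto them. A subspace lattice $\mathfrak{L}$ is a strongly closed lattice of orthogonal projections on $\mathcal{H}$ containing $0$ and $I$; it is commutative if its projections pairwise commute. It is completely distributive if the two infinite distributive laws $\wedge_{\alpha\in I}\vee_{\beta\in J_\alpha}E_{\beta\alpha}=\vee_{\varphi}\wedge_{\alpha\in I}E_{\varphi(\alpha)\alpha}$ and its dual (with $\wedge,\vee$ exchanged) hold for all families in $\mathfrak{L}$, where $\varphi$ ranges over the choice functions in $\prod_\alpha J_\alpha$. $\operatorname{Alg}\mathfrak{L}$ is the algebra of all bounded operators on $\mathcal{H}$ leaving every element of $\mathfrak{L}$ invariant. For $M\in\mathfrak{L}$, $M_-=\vee\{N\in\mathfrak{L}: M\not\leq N\}$, and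 $M_-^\perp=(M_-)^\perp$. The operator $x\otimes f^*$ is $(x\otimes f^* )(h)=\langle h,f\rangle x$; it lies in $\operatorname{Alg}\mathfrak{L}$ whenever $x\in N$ and $f\in N_-^\perp$ for some $N\in\mathfrak{L}$. A rank preserving map is a linear map $\Phi:\operatorname{Alg}\mathfrak{L}\to\operatorname{Alg}\mathfrak{L}$ with $\operatorname{rank}\Phi(A)=\operatorname{rank}A$ for every finite rank $A\in\operatorname{Alg}\mathfrak{L}$. Weakly continuous means continuous for the weak operator topology. Let $N\in\mathfrak{L}$ with $N\neq0$, $N_-\neq I$. $N$ is consistent with respect to $\Phi$ if there exist linear maps $U:N\to\mathcal{H}$ and $V:N_-^\perp\to\mathcal{H}$ with $\Phi(x\otimes f^* )=U(x)\otimes V(f)^*$ for all $x\in N$, $f\in N_-^\perp$. $N$ is twisted with respect to $\Phi$ if there exist conjugate linear maps $U:N_-^\perp\to\mathcal{H}$ and $V:N\to\mathcal{H}$ with $\Phi(x\otimes f^* )=U(f)\otimes V(x)^*$ for all $x\in N$, $f\in N_-^\perp$. (Consistent and twisted elements are, by definition, nonzero with $N_-\ne I$.) $N\in\mathfrak{L}$ is isolated if $\dim N=1$ and $N^\perp\in\mathfrak{L}$. For a projection $P$, $P\mathfrak{L}P=\{PEP:E\in\mathfrak{L}\}$, regarded as a lattice of subspaces of $P\mathcal{H}$, and $\operatorname{Alg}(P\mathfrak{L}P)$ is the corresponding algebra of operators on $P\mathcal{H}$; the direct sum is with respect to the orthogonal decomposition $\mathcal{H}=M_i\oplus M_c\oplus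 M_t$ (summands may be zero). *)

theory Defs
  imports "HOL-Analysis.Analysis"
begin

section \<open>Complex Hilbert spaces\<close>

text \<open>The norm and the topology are those of the real Hilbert space with inner product \<open>Re \<langle>x, y\<rangle>\<close>,
  so that \<open>norm x ^ 2 = Re \<langle>x, x\<rangle>\<close>. The complex inner product is linear in its first argument.\<close>

class chilbert_space = real_inner + complete_space +
  fixes scaleC :: "complex \<Rightarrow> 'a \<Rightarrow> 'a" (infixr "*\<^sub>C" 75)
    and cinner :: "'a \<Rightarrow> 'a \<Rightarrow> complex"
  assumes scaleC_add_right: "c *\<^sub>C (x + y) = c *\<^sub>C x + c *\<^sub>C y"
    and scaleC_add_left: "(c + d) *\<^sub>C x = c *\<^sub>C x + d *\<^sub>C x"
    and scaleC_scaleC: "c *\<^sub>C d *\<^sub>C x = (c * d) *\<^sub>C x"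
    and scaleC_one: "1 *\<^sub>C x = x"
    and scaleR_scaleC: "r *\<^sub>R x = complex_of_real r *\<^sub>C x"
    and cinner_commute: "cinner x y = cnj (cinner y x)"
    and cinner_add_left: "cinner (x + y) z = cinner x z + cinner y z"
    and cinner_scaleC_left: "cinner (c *\<^sub>C x) y = c * cinner x y"
    and inner_eq_Re_cinner: "inner x y = Re (cinner x y)"

instantiation complex :: chilbert_space
begin

definition scaleC_complex :: "complex \<Rightarrow> complex \<Rightarrow> complex" where
  "scaleC_complex c x = c * x"

definition cinner_complex :: "complex \<Rightarrow> complex \<Rightarrow> complex" where
  "cinner_complex x y = x * cnj y"

instance
  by standard
    (auto simp: scaleC_complex_def cinner_complex_def algebra_simps scaleR_conv_of_real
      inner_complex_def)

end

global_interpretation complex_vector: vector_space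
    "scaleC :: complex \<Rightarrow> 'a \<Rightarrow> 'a::chilbert_space"
  defines csubspace = complex_vector.subspace
    and cspan = complex_vector.span
    and cdim = complex_vector.dim
  by unfold_locales (simp_all add: scaleC_add_right scaleC_add_left scaleC_scaleC scaleC_one)

definition perp :: "'a::chilbert_space set \<Rightarrow> 'a set" where
  "perp S = {x. \<forall>y\<in>S. cinner x y = 0}"

text \<open>The orthogonal projection onto a closed subspace \<open>S\<close>.\<close>

definition proj :: "'a::chilbert_space set \<Rightarrow> 'a \<Rightarrow> 'a" where
  "proj S x = (THE y. y \<in> S \<and> x - y \<in> perp S)"

definition ominus :: "'a::chilbert_space set \<Rightarrow> 'a set \<Rightarrow> 'a set" where
  "ominus M K = M \<inter> perp K"

text \<open>The join of a family of closed subspaces; the meet is the intersection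
  (\<open>\<Inter>{} = UNIV\<close> is the whole space).\<close>

definition join :: "'a::chilbert_space set set \<Rightarrow> 'a set" where
  "join \<S> = closure (cspan (\<Union>\<S>))"

definition orthogonal_decomposition ::
    "'a::chilbert_space set \<Rightarrow> 'a set \<Rightarrow> 'a set \<Rightarrow> bool" where
  "orthogonal_decomposition K L M \<longleftrightarrow>
     (\<forall>x\<in>K. \<forall>y\<in>L. cinner x y = 0) \<and>
     (\<forall>x\<in>K. \<forall>y\<in>M. cinner x y = 0) \<and>
     (\<forall>x\<in>L. \<forall>y\<in>M. cinner x y = 0) \<and>
     (\<forall>h. \<exists>x\<in>K. \<exists>y\<in>L. \<exists>z\<in>M. h = x + y + z)"


section \<open>Operators\<close>

definition clinear_on :: "'a::chilbert_space set \<Rightarrow> ('a \<Rightarrow> 'b::chilbert_space) \<Rightarrow> bool" where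
  "clinear_on S f \<longleftrightarrow>
     (\<forall>x\<in>S. \<forall>y\<in>S. f (x + y) = f x + f y) \<and> (\<forall>c. \<forall>x\<in>S. f (c *\<^sub>C x) = c *\<^sub>C f x)"

definition conj_linear_on :: "'a::chilbert_space set \<Rightarrow> ('a \<Rightarrow> 'b::chilbert_space) \<Rightarrow> bool" where
  "conj_linear_on S f \<longleftrightarrow>
     (\<forall>x\<in>S. \<forall>y\<in>S. f (x + y) = f x + f y) \<and> (\<forall>c. \<forall>x\<in>S. f (c *\<^sub>C x) = cnj c *\<^sub>C f x)"

text \<open>Bounded operators on a subspace \<open>K\<close>. An operator on \<open>K\<close> is represented by a function
  which is \<open>undefined\<close> outside \<open>K\<close>, so that equality of operators on \<open>K\<close> is equality of functions;
  for \<open>K = UNIV\<close> the condition is void.\<close>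

definition bounded_ops :: "'a::chilbert_space set \<Rightarrow> ('a \<Rightarrow> 'a) set" where
  "bounded_ops K = {A \<in> K \<rightarrow>\<^sub>E K. clinear_on K A \<and> (\<exists>c. \<forall>x\<in>K. norm (A x) \<le> c * norm x)}"

text \<open>\<open>Alg_on K \<LL>\<close> is the algebra of a family \<open>\<LL>\<close> of subspaces of \<open>K\<close>, as operators on \<open>K\<close>.\<close>

definition Alg_on :: "'a::chilbert_space set \<Rightarrow> 'a set set \<Rightarrow> ('a \<Rightarrow> 'a) set" where
  "Alg_on K \<LL> = {A \<in> bounded_ops K. \<forall>E\<in>\<LL>. A ` E \<subseteq> E}"

abbreviation Alg :: "'a::chilbert_space set set \<Rightarrow> ('a \<Rightarrow> 'a) set" where
  "Alg \<LL> \<equiv> Alg_on UNIV \<LL>"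

text \<open>\<open>compression P \<LL> = P \<LL> P\<close>; each operator \<open>P E P\<close> is identified with its range.\<close>

definition compression :: "'a::chilbert_space set \<Rightarrow> 'a set set \<Rightarrow> 'a set set" where
  "compression P \<LL> = (\<lambda>E. range (proj P \<circ> proj E \<circ> proj P)) ` \<LL>"

text \<open>The direct sum of sets of operators on \<open>K\<close>, \<open>L\<close>, \<open>M\<close> with respect to
  an orthogonal decomposition of the whole space into \<open>K\<close>, \<open>L\<close>, \<open>M\<close>.\<close>

definition direct_sum_ops ::
    "'a::chilbert_space set \<Rightarrow> ('a \<Rightarrow> 'a) set \<Rightarrow> 'a set \<Rightarrow> ('a \<Rightarrow> 'a) set \<Rightarrow>
     'a set \<Rightarrow> ('a \<Rightarrow> 'a) set \<Rightarrow> ('a \<Rightarrow> 'a) set" where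
  "direct_sum_ops K \<A> L \<B> M \<C> =
     {\<lambda>h. A (proj K h) + B (proj L h) + C (proj M h) | A B C. A \<in> \<A> \<and> B \<in> \<B> \<and> C \<in> \<C>}"

definition rank_one :: "'a::chilbert_space \<Rightarrow> 'a \<Rightarrow> 'a \<Rightarrow> 'a" where
  "rank_one x f = (\<lambda>h. cinner h f *\<^sub>C x)"

definition finite_rank :: "('a::chilbert_space \<Rightarrow> 'a) \<Rightarrow> bool" where
  "finite_rank A \<longleftrightarrow> (\<exists>B. finite B \<and> range A \<subseteq> cspan B)"

definition rank_op :: "('a::chilbert_space \<Rightarrow> 'a) \<Rightarrow> nat" where
  "rank_op A = cdim (range A)"

text \<open>Both topologies live on the set of bounded operators on the whole space. The first one is the
  strong operator topology of \<^theory>\<open>HOL-Analysis.Bounded_Linear_Function\<close>, for complex linear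
  operators given as functions.\<close>

definition sot :: "('a::chilbert_space \<Rightarrow> 'a) topology" where
  "sot = pullback_topology (bounded_ops UNIV) (\<lambda>A x. A x) euclidean"

definition wot :: "('a::chilbert_space \<Rightarrow> 'a) topology" where
  "wot = pullback_topology (bounded_ops UNIV) (\<lambda>A (x, y). cinner (A x) y) euclidean"


section \<open>Subspace lattices\<close>

definition subspace_lattice :: "'a::chilbert_space set set \<Rightarrow> bool" where
  "subspace_lattice \<LL> \<longleftrightarrow>
     (\<forall>E\<in>\<LL>. csubspace E \<and> closed E) \<and>
     {0} \<in> \<LL> \<and> UNIV \<in> \<LL> \<and>
     (\<forall>E\<in>\<LL>. \<forall>F\<in>\<LL>. E \<inter> F \<in> \<LL> \<and> join {E, F} \<in> \<LL>) \<and>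
     closedin sot (proj ` \<LL>)"

definition commutative_lattice :: "'a::chilbert_space set set \<Rightarrow> bool" where
  "commutative_lattice \<LL> \<longleftrightarrow> (\<forall>E\<in>\<LL>. \<forall>F\<in>\<LL>. proj E \<circ> proj F = proj F \<circ> proj E)"

text \<open>Here \<open>\<alpha>\<close> ranges over sets of subspaces and \<open>\<beta>\<close> over subspaces, but this covers families
  with arbitrary index sets: replace each family \<open>(E \<beta> \<alpha>)\<^sub>\<beta>\<close> by the set of its members, take these sets
  as the new \<open>\<alpha>\<close> and their members as the new \<open>\<beta>\<close>. The left-hand sides do not change, and the terms on
  the right-hand sides become some of the original ones. As right \<open>\<le>\<close> left always holds in the first
  law and left \<open>\<le>\<close> right in the second, the laws for the new families imply the original ones.\<close>

definition completely_distributive :: "'a::chilbert_space set set \<Rightarrow> bool" where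
  "completely_distributive \<LL> \<longleftrightarrow>
     (\<forall>(I :: 'a set set set) (J :: 'a set set \<Rightarrow> 'a set set) (E :: 'a set \<Rightarrow> 'a set set \<Rightarrow> 'a set).
        (\<forall>\<alpha>\<in>I. \<forall>\<beta>\<in>J \<alpha>. E \<beta> \<alpha> \<in> \<LL>) \<longrightarrow>
          (\<Inter>\<alpha>\<in>I. join ((\<lambda>\<beta>. E \<beta> \<alpha>) ` J \<alpha>)) = join ((\<lambda>\<phi>. \<Inter>\<alpha>\<in>I. E (\<phi> \<alpha>) \<alpha>) ` Pi\<^sub>E I J) \<and>
          join ((\<lambda>\<alpha>. \<Inter>\<beta>\<in>J \<alpha>. E \<beta> \<alpha>) ` I) = (\<Inter>\<phi>\<in>Pi\<^sub>E I J. join ((\<lambda>\<alpha>. E (\<phi> \<alpha>) \<alpha>) ` I)))"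

text \<open>\<open>lower \<LL> M = M\<^sub>-\<close>\<close>

definition lower :: "'a::chilbert_space set set \<Rightarrow> 'a set \<Rightarrow> 'a set" where
  "lower \<LL> M = join {N \<in> \<LL>. \<not> M \<subseteq> N}"

definition isolated :: "'a::chilbert_space set set \<Rightarrow> 'a set \<Rightarrow> bool" where
  "isolated \<LL> N \<longleftrightarrow> N \<in> \<LL> \<and> cdim N = 1 \<and> perp N \<in> \<LL>"


section \<open>Rank preserving maps\<close>

text \<open>As \<open>cdim\<close> is \<open>0\<close> on infinite dimensional spaces, it has to be required explicitly that
  \<open>\<Phi> A\<close> has finite rank.\<close>

definition rank_preserving_map ::
    "'a::chilbert_space set set \<Rightarrow> (('a \<Rightarrow> 'a) \<Rightarrow> ('a \<Rightarrow> 'a)) \<Rightarrow> bool" where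
  "rank_preserving_map \<LL> \<Phi> \<longleftrightarrow>
     \<Phi> \<in> Alg \<LL> \<rightarrow> Alg \<LL> \<and>
     (\<forall>A\<in>Alg \<LL>. \<forall>B\<in>Alg \<LL>. \<Phi> (\<lambda>x. A x + B x) = (\<lambda>x. \<Phi> A x + \<Phi> B x)) \<and>
     (\<forall>c. \<forall>A\<in>Alg \<LL>. \<Phi> (\<lambda>x. c *\<^sub>C A x) = (\<lambda>x. c *\<^sub>C \<Phi> A x)) \<and>
     (\<forall>A\<in>Alg \<LL>. finite_rank A \<longrightarrow> finite_rank (\<Phi> A) \<and> rank_op (\<Phi> A) = rank_op A)"

definition weakly_continuous ::
    "'a::chilbert_space set set \<Rightarrow> (('a \<Rightarrow> 'a) \<Rightarrow> ('a \<Rightarrow> 'a)) \<Rightarrow> bool" where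
  "weakly_continuous \<LL> \<Phi> \<longleftrightarrow>
     continuous_map (subtopology wot (Alg \<LL>)) (subtopology wot (Alg \<LL>)) \<Phi>"

definition consistent ::
    "'a::chilbert_space set set \<Rightarrow> (('a \<Rightarrow> 'a) \<Rightarrow> ('a \<Rightarrow> 'a)) \<Rightarrow> 'a set \<Rightarrow> bool" where
  "consistent \<LL> \<Phi> N \<longleftrightarrow>
     N \<in> \<LL> \<and> N \<noteq> {0} \<and> lower \<LL> N \<noteq> UNIV \<and>
     (\<exists>U V. clinear_on N U \<and> clinear_on (perp (lower \<LL> N)) V \<and>
        (\<forall>x\<in>N. \<forall>f\<in>perp (lower \<LL> N). \<Phi> (rank_one x f) = rank_one (U x) (V f)))"

definition twisted ::
    "'a::chilbert_space set set \<Rightarrow> (('a \<Rightarrow> 'a) \<Rightarrow> ('a \<Rightarrow> 'a)) \<Rightarrow> 'a set \<Rightarrow> bool" where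
  "twisted \<LL> \<Phi> N \<longleftrightarrow>
     N \<in> \<LL> \<and> N \<noteq> {0} \<and> lower \<LL> N \<noteq> UNIV \<and>
     (\<exists>U V. conj_linear_on (perp (lower \<LL> N)) U \<and> conj_linear_on N V \<and>
        (\<forall>x\<in>N. \<forall>f\<in>perp (lower \<LL> N). \<Phi> (rank_one x f) = rank_one (U f) (V x)))"

definition M_i :: "'a::chilbert_space set set \<Rightarrow> 'a set" where
  "M_i \<LL> = join {E. isolated \<LL> E}"

definition M_c :: "'a::chilbert_space set set \<Rightarrow> (('a \<Rightarrow> 'a) \<Rightarrow> ('a \<Rightarrow> 'a)) \<Rightarrow> 'a set" where
  "M_c \<LL> \<Phi> = ominus (join {E. consistent \<LL> \<Phi> E}) (M_i \<LL>)"

definition M_t :: "'a::chilbert_space set set \<Rightarrow> (('a \<Rightarrow> 'a) \<Rightarrow> ('a \<Rightarrow> 'a)) \<Rightarrow> 'a set" where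
  "M_t \<LL> \<Phi> = ominus (join {E. twisted \<LL> \<Phi> E}) (M_i \<LL>)"

end

theory Submission
  imports Defs
begin

text \<open>For \<open>N \<in> \<LL>\<close> with \<open>N \<noteq> 0\<close> and \<open>N\<^sub>- \<noteq> I\<close> the operators \<open>x \<otimes> f\<^sup>*\<close> with \<open>x \<in> N\<close> and \<open>f \<in> N\<^sub>-\<^sup>\<bottom>\<close> form a
  block of operators of rank at most one in the algebra. By complete distributivity every
  element of \<open>\<LL>\<close> is generated by such \<open>N\<close> below it (\<open>lattice_element_subsetI\<close>), so these blocks
  suffice to control the lattice.

  On a block, a rank preserving map is consistent or twisted (\<open>consistent_or_twisted\<close>). For fixed \<open>x\<close>
  the images of the operators \<open>x \<otimes> f\<^sup>*\<close> form a linear space of operators of rank at most one, and the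
  nonzero ones have a common range or a common kernel; the same is true for fixed \<open>f\<close>. Since sums of
  rank two are preserved, the alternative for \<open>x\<close> and that for \<open>f\<close> are opposite to each other, and
  this pins down the form of the whole block (\<open>rank_one_family_dichotomy\<close>).

  The two properties pass from \<open>N\<close> to every nonzero \<open>K\<close> below it. The blocks of \<open>K\<close> and \<open>N\<close> overlap, and if
  their forms were different, then the image of some operator of rank two, built from one operator
  of each block, would have rank at most one (\<open>blocks_comparable\<close>, \<open>consistent_hereditary\<close>,
  \<open>twisted_hereditary\<close>). An element with both properties has a one-dimensional block, and by
  commutativity it is isolated (\<open>isolatedI\<close>). Hence the meet of a consistent and a twisted element is
  generated by isolated ones and lies in \<open>M_i\<close> (\<open>consistent_meet_twisted\<close>).

  The complement of each isolated element is in \<open>\<LL>\<close>, so \<open>M_i\<close> and its complement are invariant under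
  the algebra, and therefore so are \<open>M_c\<close> and \<open>M_t\<close>. As the projections of \<open>\<LL>\<close> commute, the statement
  on meets makes \<open>M_c\<close> and \<open>M_t\<close> orthogonal, and together with \<open>M_i\<close> they span the space because every
  generating \<open>N\<close> is consistent or twisted (\<open>orthogonal_decomposition_M\<close>). An orthogonal decomposition
  into invariant subspaces splits the algebra (\<open>Alg_eq_direct_sum_ops\<close>).\<close>

section \<open>The geometry of complex Hilbert space\<close>

lemma cinner_add_right: "cinner x (y + z) = cinner x y + cinner x z"
  by (metis cinner_add_left cinner_commute complex_cnj_add)

lemma cinner_scaleC_right: "cinner x (c *\<^sub>C y) = cnj c * cinner x y"
  by (metis cinner_scaleC_left cinner_commute complex_cnj_mult complex_cnj_cnj)

lemma cinner_zero_left [simp]: "cinner 0 x = 0"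
  using cinner_add_left[of 0 0 x] by simp

lemma cinner_zero_right [simp]: "cinner x 0 = 0"
  using cinner_add_right[of x 0 0] by simp

lemma cinner_minus_left: "cinner (- x) y = - cinner x y"
  using cinner_add_left[of x "- x" y] by (simp add: eq_neg_iff_add_eq_0 add.commute)

lemma cinner_diff_left: "cinner (x - y) z = cinner x z - cinner y z"
  using cinner_add_left[of x "- y" z] by (simp add: cinner_minus_left)

lemma cinner_diff_right: "cinner x (y - z) = cinner x y - cinner x z"
  by (metis cinner_diff_left cinner_commute complex_cnj_diff)

lemma cinner_eq_0_commute: "cinner x y = 0 \<longleftrightarrow> cinner y x = 0"
  by (metis cinner_commute complex_cnj_zero_iff)

lemma cinner_self: "cinner x x = complex_of_real ((norm x)\<^sup>2)"
proof (rule complex_eqI)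
  show "Im (cinner x x) = Im (complex_of_real ((norm x)\<^sup>2))"
    using arg_cong[OF cinner_commute[of x x], of Im] by simp
qed (simp add: inner_eq_Re_cinner[symmetric] power2_norm_eq_inner del: of_real_power)

lemma cinner_self_eq_0 [simp]: "cinner x x = 0 \<longleftrightarrow> x = 0"
  by (simp add: cinner_self)

lemma norm_scaleC: "norm (c *\<^sub>C x) = cmod c * norm x"
proof -
  have "complex_of_real ((norm (c *\<^sub>C x))\<^sup>2) = c * cnj c * complex_of_real ((norm x)\<^sup>2)"
    unfolding cinner_self[symmetric] by (simp add: cinner_scaleC_left cinner_scaleC_right)
  also have "\<dots> = complex_of_real ((cmod c * norm x)\<^sup>2)"
    by (simp add: complex_norm_square[symmetric] power_mult_distrib)
  finally show ?thesis
    by (metis of_real_eq_iff norm_ge_zero mult_nonneg_nonneg power2_eq_iff_nonneg)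
qed

lemma bounded_linear_scaleC: "bounded_linear (\<lambda>x. c *\<^sub>C x :: 'a::chilbert_space)"
proof (rule bounded_linear_intro[where K = "cmod c"])
  show "c *\<^sub>C (r *\<^sub>R x) = r *\<^sub>R c *\<^sub>C x" for r and x :: 'a
    by (simp add: scaleR_scaleC scaleC_scaleC mult.commute)
qed (simp_all add: scaleC_add_right norm_scaleC mult.commute)

lemma cinner_eq_Complex: "cinner x y = Complex (inner x y) (inner x (\<i> *\<^sub>C y))"
  by (rule complex_eqI) (simp_all add: inner_eq_Re_cinner cinner_scaleC_right)

lemma closed_csubspace_perp: "csubspace (perp S)" "closed (perp S)"
proof -
  show "csubspace (perp S)"
    by (rule complex_vector.subspaceI) (auto simp: perp_def cinner_add_left cinner_scaleC_left)
  have "perp S = (\<Inter>y\<in>S. {x. inner y x = 0} \<inter> {x. inner (\<i> *\<^sub>C y) x = 0})"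
    by (auto simp: perp_def cinner_eq_Complex complex_eq_iff inner_commute)
  then show "closed (perp S)"
    by (auto intro!: closed_INT closed_Int closed_hyperplane)
qed

lemma subset_perp_commute: "S \<subseteq> perp T \<longleftrightarrow> T \<subseteq> perp S"
  unfolding perp_def using cinner_eq_0_commute by blast

lemma csubspace_closure:
  fixes S :: "'a::chilbert_space set"
  assumes "csubspace S"
  shows "csubspace (closure S)"
proof (rule complex_vector.subspaceI)
  show "0 \<in> closure S"
    using assms complex_vector.subspace_0 closure_subset by blast
  show "x + y \<in> closure S" if "x \<in> closure S" "y \<in> closure S" for x y
  proof -
    obtain f g where "\<forall>n. f n \<in> S" "f \<longlonglongrightarrow> x" "\<forall>n. g n \<in> S" "g \<longlonglongrightarrow> y"
      using \<open>x \<in> closure S\<close> \<open>y \<in> closure S\<close> unfolding closure_sequential by blast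
    then show ?thesis
      unfolding closure_sequential
      by (intro exI[of _ "\<lambda>n. f n + g n"])
         (auto intro: tendsto_add complex_vector.subspace_add[OF assms])
  qed
  show "c *\<^sub>C x \<in> closure S" if "x \<in> closure S" for c x
  proof -
    have "(*\<^sub>C) c ` closure S \<subseteq> closure ((*\<^sub>C) c ` S)"
      by (rule closure_bounded_linear_image_subset[OF bounded_linear_scaleC])
    also have "\<dots> \<subseteq> closure S"
      by (rule closure_mono) (auto intro: complex_vector.subspace_scale[OF assms])
    finally show ?thesis using that by blast
  qed
qed

lemma closed_csubspace_join: "csubspace (join \<S>)" "closed (join \<S>)"
  unfolding join_def by (auto intro: csubspace_closure)

lemma join_upper: "K \<in> \<S> \<Longrightarrow> K \<subseteq> join \<S>"
  unfolding join_def by (meson Sup_upper closure_subset complex_vector.span_superset order_trans)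

lemma join_least:
  assumes "csubspace T" "closed T" "\<And>K. K \<in> \<S> \<Longrightarrow> K \<subseteq> T"
  shows "join \<S> \<subseteq> T"
  unfolding join_def
  by (intro closure_minimal complex_vector.span_minimal Sup_least assms)

lemma join_mono: "\<S> \<subseteq> \<T> \<Longrightarrow> join \<S> \<subseteq> join \<T>"
  by (intro join_least closed_csubspace_join) (auto dest: join_upper)

text \<open>The classical argument: a minimizing sequence for the distance is Cauchy by the parallelogram
  law, and at its limit the first variation of the distance vanishes.\<close>

lemma orthogonal_projection_exists:
  fixes S :: "'a::chilbert_space set"
  assumes S: "csubspace S" "closed S"
  shows "\<exists>y\<in>S. x - y \<in> perp S"
proof -
  have rsub: "r *\<^sub>R y \<in> S" if "y \<in> S" for r y
    using that by (simp add: scaleR_scaleC complex_vector.subspace_scale[OF S(1)])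
  define d where "d = Inf ((\<lambda>y. (norm (x - y))\<^sup>2) ` S)"
  have bdd: "bdd_below ((\<lambda>y. (norm (x - y))\<^sup>2) ` S)"
    by (rule bdd_belowI[of _ 0]) auto
  have ne: "S \<noteq> {}" using S(1) complex_vector.subspace_0 by blast
  have d_le: "d \<le> (norm (x - y))\<^sup>2" if "y \<in> S" for y
    unfolding d_def using bdd that by (intro cINF_lower) auto
  have "\<exists>y\<in>S. (norm (x - y))\<^sup>2 < d + 1 / real (Suc n)" for n
  proof -
    have "d < d + 1 / real (Suc n)" by simp
    then show ?thesis
      unfolding d_def using cINF_less_iff[OF ne bdd] by blast
  qed
  then obtain y where y: "\<And>n. y n \<in> S" "\<And>n. (norm (x - y n))\<^sup>2 < d + 1 / real (Suc n)"
    by metis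
  have par: "(norm (y m - y n))\<^sup>2 < 2 / real (Suc m) + 2 / real (Suc n)" for m n
  proof -
    have "(1/2) *\<^sub>R (y m + y n) \<in> S"
      by (intro rsub complex_vector.subspace_add[OF S(1)] y)
    then have "d \<le> (norm (x - (1/2) *\<^sub>R (y m + y n)))\<^sup>2" by (rule d_le)
    moreover have "(norm (y m - y n))\<^sup>2 = 2 * (norm (x - y m))\<^sup>2 + 2 * (norm (x - y n))\<^sup>2
        - 4 * (norm (x - (1/2) *\<^sub>R (y m + y n)))\<^sup>2"
      by (simp add: power2_norm_eq_inner inner_diff_left inner_diff_right inner_add_left
          inner_add_right inner_commute algebra_simps)
    ultimately show ?thesis using y(2)[of m] y(2)[of n] by simp
  qed
  have "Cauchy y"
  proof (rule metric_CauchyI)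
    fix e :: real assume "e > 0"
    then obtain M :: nat where M: "real M > 4 / e\<^sup>2" "M > 0"
      by (metis reals_Archimedean2 gr0I of_nat_0 not_less_iff_gr_or_eq zero_less_divide_iff
          zero_less_numeral zero_less_power)
    have "dist (y m) (y n) < e" if "m \<ge> M" "n \<ge> M" for m n
    proof -
      have "2 / real (Suc m) \<le> 2 / real M" "2 / real (Suc n) \<le> 2 / real M"
        using that M by (auto intro!: divide_left_mono)
      then have "(norm (y m - y n))\<^sup>2 < 4 / real M" using par[of m n] by simp
      also have "\<dots> < e\<^sup>2" using M \<open>e > 0\<close> by (simp add: field_simps)
      finally show ?thesis
        using \<open>e > 0\<close> by (simp add: dist_norm power_less_imp_less_base less_imp_le)
    qed
    then show "\<exists>M. \<forall>m\<ge>M. \<forall>n\<ge>M. dist (y m) (y n) < e" by blast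
  qed
  then obtain z where z: "y \<longlonglongrightarrow> z"
    using Cauchy_convergent convergent_def by blast
  have zS: "z \<in> S" using S(2) y(1) z closed_sequentially by blast
  have "(\<lambda>n. d + 1 / real (Suc n)) \<longlonglongrightarrow> d + 0"
    by (intro tendsto_intros LIMSEQ_Suc[OF lim_1_over_n])
  moreover have "(\<lambda>n. (norm (x - y n))\<^sup>2) \<longlonglongrightarrow> (norm (x - z))\<^sup>2"
    by (intro tendsto_intros z)
  ultimately have "(norm (x - z))\<^sup>2 \<le> d"
    using LIMSEQ_le[of "\<lambda>n. (norm (x - y n))\<^sup>2" _ "\<lambda>n. d + 1 / real (Suc n)"] y(2)
    by (simp add: less_imp_le)
  then have min: "dist x z \<le> dist x w" if "w \<in> S" for w
    using d_le[OF that] by (simp add: dist_norm) (meson norm_ge_zero order_trans power2_le_imp_le)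
  have "convex S"
    by (rule convexI) (intro complex_vector.subspace_add[OF S(1)] rsub)
  then have le: "inner (x - z) (w - z) \<le> 0" if "w \<in> S" for w
    using any_closest_point_dot[of S z w x] S(2) zS that min by blast
  have re: "inner (x - z) w = 0" if "w \<in> S" for w
  proof -
    have "inner (x - z) ((z + w) - z) \<le> 0" "inner (x - z) ((z + - w) - z) \<le> 0"
      using that zS complex_vector.subspace_add[OF S(1)] complex_vector.subspace_neg[OF S(1)]
      by (blast intro: le)+
    then show ?thesis by simp
  qed
  have "cinner (x - z) w = 0" if "w \<in> S" for w
    using re[OF that] re[OF complex_vector.subspace_scale[OF S(1) that, of "\<i>"]]
    by (simp add: cinner_eq_Complex complex_eq_iff)
  then show ?thesis using zS by (auto simp: perp_def)
qed

lemma in_perp_both_eq_0: "x \<in> S \<Longrightarrow> x \<in> perp S \<Longrightarrow> x = 0"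
  by (auto simp: perp_def)

lemma proj_eqI:
  assumes "csubspace S" "y \<in> S" "x - y \<in> perp S"
  shows "proj S x = y"
  unfolding proj_def
proof (rule the_equality)
  fix z assume z: "z \<in> S \<and> x - z \<in> perp S"
  have "z - y \<in> S" using z assms by (simp add: complex_vector.subspace_diff)
  moreover have "(x - y) - (x - z) \<in> perp S"
    using z assms(3) closed_csubspace_perp complex_vector.subspace_diff by blast
  then have "z - y \<in> perp S" by simp
  ultimately show "z = y" using in_perp_both_eq_0 by fastforce
qed (use assms in blast)

lemma
  assumes "csubspace S" "closed S"
  shows proj_in: "proj S x \<in> S" and diff_proj_in_perp: "x - proj S x \<in> perp S"
  using orthogonal_projection_exists[OF assms, of x] proj_eqI[OF assms(1)] by auto

lemma proj_id: "csubspace S \<Longrightarrow> x \<in> S \<Longrightarrow> proj S x = x"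
  by (rule proj_eqI) (auto simp: perp_def)

lemma proj_eq_0: "csubspace S \<Longrightarrow> x \<in> perp S \<Longrightarrow> proj S x = 0"
  by (rule proj_eqI) (auto simp: complex_vector.subspace_0)

lemma proj_add:
  assumes "csubspace S" "closed S"
  shows "proj S (x + y) = proj S x + proj S y"
proof (rule proj_eqI[OF assms(1)])
  show "proj S x + proj S y \<in> S"
    by (intro complex_vector.subspace_add assms proj_in)
  have "(x - proj S x) + (y - proj S y) \<in> perp S"
    by (intro complex_vector.subspace_add closed_csubspace_perp diff_proj_in_perp assms)
  then show "x + y - (proj S x + proj S y) \<in> perp S" by (simp add: algebra_simps)
qed

lemma proj_scaleC:
  assumes "csubspace S" "closed S"
  shows "proj S (c *\<^sub>C x) = c *\<^sub>C proj S x"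
proof (rule proj_eqI[OF assms(1)])
  show "c *\<^sub>C proj S x \<in> S"
    by (intro complex_vector.subspace_scale assms proj_in)
  have "c *\<^sub>C (x - proj S x) \<in> perp S"
    by (intro complex_vector.subspace_scale closed_csubspace_perp diff_proj_in_perp assms)
  then show "c *\<^sub>C x - c *\<^sub>C proj S x \<in> perp S"
    by (simp add: complex_vector.scale_right_diff_distrib)
qed

lemma proj_diff:
  assumes "csubspace S" "closed S"
  shows "proj S (x - y) = proj S x - proj S y"
  using proj_add[OF assms, of "x - y" y] by simp

lemma norm_orthogonal_add:
  assumes "cinner x y = 0"
  shows "(norm (x + y))\<^sup>2 = (norm x)\<^sup>2 + (norm y)\<^sup>2"
proof -
  have "inner x y = 0" using assms by (simp add: inner_eq_Re_cinner)
  then show ?thesis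
    by (simp add: power2_norm_eq_inner inner_add_left inner_add_right inner_commute[of y x])
qed

lemma norm_proj_le:
  assumes "csubspace S" "closed S"
  shows "norm (proj S x) \<le> norm x"
proof -
  have "cinner (proj S x) (x - proj S x) = 0"
    using diff_proj_in_perp[OF assms, of x] proj_in[OF assms, of x] cinner_eq_0_commute
    by (auto simp: perp_def)
  from norm_orthogonal_add[OF this] have "(norm (proj S x))\<^sup>2 \<le> (norm x)\<^sup>2" by simp
  then show ?thesis by (rule power2_le_imp_le) simp
qed

lemma proj_in_bounded_ops:
  assumes "csubspace S" "closed S"
  shows "proj S \<in> bounded_ops UNIV"
  using proj_add[OF assms] proj_scaleC[OF assms] norm_proj_le[OF assms]
  by (auto simp: bounded_ops_def clinear_on_def PiE_UNIV_domain intro!: exI[of _ 1])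

lemma cinner_proj_commute:
  assumes "csubspace S" "closed S"
  shows "cinner (proj S x) y = cinner x (proj S y)"
proof -
  have "cinner (y - proj S y) (proj S x) = 0" "cinner (x - proj S x) (proj S y) = 0"
    using diff_proj_in_perp[OF assms] proj_in[OF assms] by (auto simp: perp_def)
  then have "cinner (proj S x) (y - proj S y) = 0" "cinner (x - proj S x) (proj S y) = 0"
    by (simp_all add: cinner_eq_0_commute)
  then show ?thesis by (simp add: cinner_diff_left cinner_diff_right)
qed

lemma perp_perp:
  assumes "csubspace S" "closed S"
  shows "perp (perp S) = S"
proof
  show "S \<subseteq> perp (perp S)" using subset_perp_commute by blast
  show "perp (perp S) \<subseteq> S"
  proof
    fix x assume x: "x \<in> perp (perp S)"
    have "x - proj S x \<in> perp (perp S)"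
      using x proj_in[OF assms] \<open>S \<subseteq> perp (perp S)\<close>
      by (blast intro: complex_vector.subspace_diff closed_csubspace_perp)
    then have "x - proj S x = 0"
      using diff_proj_in_perp[OF assms] in_perp_both_eq_0 by blast
    then show "x \<in> S" using proj_in[OF assms, of x] by simp
  qed
qed

lemma perp_eq_0_iff:
  assumes "csubspace S" "closed S"
  shows "perp S = {0} \<longleftrightarrow> S = UNIV"
proof
  assume "perp S = {0}"
  then have "perp (perp S) = UNIV" by (auto simp: perp_def)
  then show "S = UNIV" using perp_perp[OF assms] by simp
next
  assume "S = UNIV"
  then show "perp S = {0}" using in_perp_both_eq_0 by (auto simp: perp_def)
qed

lemma proj_perp:
  assumes "csubspace S" "closed S"
  shows "proj (perp S) x = x - proj S x"
  using proj_in[OF assms]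
  by (intro proj_eqI closed_csubspace_perp diff_proj_in_perp assms) (simp add: perp_perp[OF assms])

lemma perp_join_perp:
  assumes "\<And>F. F \<in> \<F> \<Longrightarrow> csubspace F \<and> closed F"
  shows "perp (join (perp ` \<F>)) = \<Inter>\<F>"
proof
  show "perp (join (perp ` \<F>)) \<subseteq> \<Inter>\<F>"
  proof (rule Inter_greatest)
    fix F assume F: "F \<in> \<F>"
    have "perp (join (perp ` \<F>)) \<subseteq> perp (perp F)"
      using join_upper[of "perp F" "perp ` \<F>"] F by (auto simp: perp_def)
    then show "perp (join (perp ` \<F>)) \<subseteq> F" using assms[OF F] perp_perp by blast
  qed
  have "join (perp ` \<F>) \<subseteq> perp (\<Inter>\<F>)"
    by (rule join_least) (use closed_csubspace_perp in \<open>auto simp: perp_def\<close>)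
  then show "\<Inter>\<F> \<subseteq> perp (join (perp ` \<F>))" by (simp add: subset_perp_commute)
qed

text \<open>A closed subspace that is invariant under the projection onto \<open>E\<close> splits along \<open>E\<close>; hence its
  own projection leaves \<open>E\<close> invariant.\<close>

lemma proj_image_subset_commute:
  assumes E: "csubspace E" "closed E" and M: "csubspace M" "closed M"
    and inv: "proj E ` M \<subseteq> M"
  shows "proj M ` E \<subseteq> E"
proof
  fix z assume "z \<in> proj M ` E"
  then obtain x where x: "x \<in> E" "z = proj M x" by blast
  have "x - proj E (proj M x) \<in> perp M"
    unfolding perp_def
  proof safe
    fix y assume "y \<in> M"
    then have "cinner x (proj E y) = cinner (proj M x) (proj E y)"
      using inv diff_proj_in_perp[OF M, of x] by (auto simp: perp_def cinner_diff_left)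
    then show "cinner (x - proj E (proj M x)) y = 0"
      using x cinner_proj_commute[OF E] proj_id[OF E(1)]
      by (simp add: cinner_diff_left) (metis proj_id)
  qed
  then have "proj M x = proj E (proj M x)"
    using inv proj_in[OF M] by (intro proj_eqI M) blast+
  then show "z \<in> E" using x proj_in[OF E] by metis
qed


section \<open>Infinite meets and directed joins in a subspace lattice\<close>

lemma subspace_latticeD:
  assumes "subspace_lattice \<LL>" "E \<in> \<LL>"
  shows "csubspace E" "closed E"
  using assms by (auto simp: subspace_lattice_def)

text \<open>The union of an upward directed family is a subspace that is dense in the join. A vector of the
  union close to the projection of \<open>x\<close> onto the join lies in some member \<open>F\<close>, and the projection of
  \<open>x\<close> onto any member above \<open>F\<close> is at least as close. Finitely many \<open>x\<close> are served by a common
  upper bound.\<close>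

lemma proj_directed_approx:
  fixes \<F> :: "'a::chilbert_space set set"
  assumes ne: "\<F> \<noteq> {}" and sub: "\<And>F. F \<in> \<F> \<Longrightarrow> csubspace F \<and> closed F"
    and dir: "\<And>F G. F \<in> \<F> \<Longrightarrow> G \<in> \<F> \<Longrightarrow> \<exists>H\<in>\<F>. F \<subseteq> H \<and> G \<subseteq> H"
    and "finite X" and e: "e > 0"
  shows "\<exists>F\<in>\<F>. \<forall>x\<in>X. norm (proj (join \<F>) x - proj F x) < e"
proof -
  have "\<exists>F\<in>\<F>. \<forall>G\<in>\<F>. F \<subseteq> G \<longrightarrow> (\<forall>x\<in>X. norm (proj (join \<F>) x - proj G x) < e)"
    using \<open>finite X\<close>
  proof induction
    case empty
    then show ?case using ne by auto
  next
    case (insert x X)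
    then obtain F1 where F1: "F1 \<in> \<F>"
      "\<And>G z. G \<in> \<F> \<Longrightarrow> F1 \<subseteq> G \<Longrightarrow> z \<in> X \<Longrightarrow> norm (proj (join \<F>) z - proj G z) < e"
      by blast
    have "csubspace (\<Union>\<F>)"
    proof (rule complex_vector.subspaceI)
      show "0 \<in> \<Union>\<F>" using ne sub complex_vector.subspace_0 by blast
      show "c *\<^sub>C u \<in> \<Union>\<F>" if "u \<in> \<Union>\<F>" for c u
        using that sub complex_vector.subspace_scale by blast
      show "u + v \<in> \<Union>\<F>" if "u \<in> \<Union>\<F>" "v \<in> \<Union>\<F>" for u v
      proof -
        obtain F G where FG: "u \<in> F" "F \<in> \<F>" "v \<in> G" "G \<in> \<F>" using \<open>u \<in> \<Union>\<F>\<close> \<open>v \<in> \<Union>\<F>\<close> by blast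
        then obtain H where H: "H \<in> \<F>" "F \<subseteq> H" "G \<subseteq> H" using dir[OF FG(2,4)] by blast
        then have "u \<in> H" "v \<in> H" using FG by blast+
        then have "u + v \<in> H" using sub[OF H(1)] complex_vector.subspace_add by blast
        then show ?thesis using H(1) by blast
      qed
    qed
    then have "join \<F> = closure (\<Union>\<F>)"
      by (simp add: join_def complex_vector.span_eq_iff[THEN iffD2])
    define y where "y = proj (join \<F>) x"
    have y: "y \<in> join \<F>" "x - y \<in> perp (join \<F>)"
      by (auto simp: y_def intro: proj_in diff_proj_in_perp closed_csubspace_join)
    then obtain z F2 where z: "dist z y < e" "z \<in> F2" "F2 \<in> \<F>"
      using e unfolding \<open>join \<F> = closure (\<Union>\<F>)\<close> closure_approachable by blast
    have *: "norm (y - proj G x) < e" if G: "G \<in> \<F>" "F2 \<subseteq> G" for G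
    proof -
      note subG = sub[OF G(1), THEN conjunct1] sub[OF G(1), THEN conjunct2]
      have "x - y \<in> perp G"
        using y(2) join_upper[OF G(1)] by (auto simp: perp_def)
      then have "proj G x = proj G y"
        using proj_diff[OF subG, of x y] proj_eq_0[OF subG(1)] by simp
      moreover have "cinner (y - proj G y) (proj G y - z) = 0"
        using diff_proj_in_perp[OF subG, of y] proj_in[OF subG, of y] z(2) G(2)
          complex_vector.subspace_diff[OF subG(1)] by (auto simp: perp_def)
      from norm_orthogonal_add[OF this]
      have "(norm (y - proj G y))\<^sup>2 \<le> (norm (y - z))\<^sup>2" by simp
      then have "norm (y - proj G y) \<le> norm (y - z)" by (rule power2_le_imp_le) simp
      ultimately show ?thesis using z(1) by (simp add: dist_norm norm_minus_commute)
    qed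
    obtain F where F: "F \<in> \<F>" "F1 \<subseteq> F" "F2 \<subseteq> F" using dir F1(1) z(3) by blast
    show ?case
    proof (intro bexI[OF _ F(1)] ballI impI)
      fix G w assume "G \<in> \<F>" "F \<subseteq> G" "w \<in> insert x X"
      then show "norm (proj (join \<F>) w - proj G w) < e"
        using *[of G] F F1(2)[of G w] unfolding y_def by blast
    qed
  qed
  then show ?thesis by blast
qed

text \<open>The hypothesis says that every basic strong neighbourhood of the projection onto \<open>G\<close> contains a
  projection of the lattice, so closedness of the lattice applies.\<close>

lemma in_lattice_of_strong_approx:
  fixes \<LL> :: "'a::chilbert_space set set"
  assumes L: "subspace_lattice \<LL>" and G: "csubspace G" "closed G"
    and approx: "\<And>X e. finite X \<Longrightarrow> e > 0 \<Longrightarrow> \<exists>F\<in>\<LL>. \<forall>x\<in>X. norm (proj G x - proj F x) < e"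
  shows "G \<in> \<LL>"
proof (rule ccontr)
  assume "G \<notin> \<LL>"
  have range_eq: "range (proj F) = F" if "csubspace F" "closed F" for F :: "'a set"
    using proj_in[OF that] proj_id[OF that(1)] by (auto simp: image_iff) metis
  have top: "topspace sot = (bounded_ops UNIV :: ('a \<Rightarrow> 'a) set)"
    by (simp add: sot_def topspace_pullback_topology)
  have "proj G \<notin> proj ` \<LL>"
    using \<open>G \<notin> \<LL>\<close> range_eq[OF G] range_eq subspace_latticeD[OF L] by (metis imageE)
  moreover have "openin sot (topspace sot - proj ` \<LL>)"
    using L by (simp add: subspace_lattice_def closedin_def)
  then obtain U where U: "open U" "bounded_ops UNIV - proj ` \<LL> = U \<inter> bounded_ops UNIV"
    unfolding top unfolding sot_def openin_pullback_topology by auto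
  ultimately have "proj G \<in> U" using proj_in_bounded_ops[OF G] by blast
  moreover have "openin (product_topology (\<lambda>_. euclidean) UNIV) U"
    using U(1) by (simp add: open_fun_def)
  ultimately obtain X where X: "proj G \<in> PiE UNIV X" "\<And>i. open (X i)"
      "finite {i. X i \<noteq> UNIV}" "PiE UNIV X \<subseteq> U"
    using product_topology_open_contains_basis[of "\<lambda>_. euclidean" UNIV U "proj G"] by auto
  have "\<exists>e>0. ball (proj G i) e \<subseteq> X i" for i
    using X(1,2) by (metis PiE_mem UNIV_I open_contains_ball)
  then obtain \<epsilon> where \<epsilon>: "\<And>i. \<epsilon> i > 0" "\<And>i. ball (proj G i) (\<epsilon> i) \<subseteq> X i" by metis
  define e where "e = Min (insert 1 (\<epsilon> ` {i. X i \<noteq> UNIV}))"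
  have "e > 0" using X(3) \<epsilon>(1) by (simp add: e_def)
  then obtain F where F: "F \<in> \<LL>" "\<And>i. X i \<noteq> UNIV \<Longrightarrow> norm (proj G i - proj F i) < e"
    using approx[OF X(3)] by blast
  have "proj F i \<in> X i" for i
  proof (cases "X i = UNIV")
    case False
    then have "e \<le> \<epsilon> i" unfolding e_def using X(3) by (intro Min_le) auto
    then show ?thesis using F(2)[OF False] \<epsilon>(2)[of i] by (auto simp: dist_norm)
  qed simp
  then have "proj F \<in> U" using X(4) by (auto simp: PiE_UNIV_domain)
  then show False
    using U(2) F(1) proj_in_bounded_ops[OF subspace_latticeD[OF L F(1)]] by blast
qed

lemma directed_join_in_lattice:
  fixes \<LL> :: "'a::chilbert_space set set"
  assumes L: "subspace_lattice \<LL>" and "\<F> \<subseteq> \<LL>" "\<F> \<noteq> {}"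
    and "\<And>F G. F \<in> \<F> \<Longrightarrow> G \<in> \<F> \<Longrightarrow> \<exists>H\<in>\<F>. F \<subseteq> H \<and> G \<subseteq> H"
  shows "join \<F> \<in> \<LL>"
proof (rule in_lattice_of_strong_approx[OF L closed_csubspace_join])
  fix X :: "'a set" and e :: real assume "finite X" "e > 0"
  then have "\<exists>F\<in>\<F>. \<forall>x\<in>X. norm (proj (join \<F>) x - proj F x) < e"
    using assms subspace_latticeD[OF L] by (intro proj_directed_approx) blast+
  then show "\<exists>F\<in>\<LL>. \<forall>x\<in>X. norm (proj (join \<F>) x - proj F x) < e"
    using assms(2) by blast
qed

text \<open>The finite partial meets are directed downwards, so their complements are directed upwards and
  the projections onto the complements converge.\<close>

lemma Inter_in_lattice:
  fixes \<LL> :: "'a::chilbert_space set set"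
  assumes L: "subspace_lattice \<LL>" and sub: "\<S> \<subseteq> \<LL>"
  shows "\<Inter>\<S> \<in> \<LL>"
proof -
  define \<F> where "\<F> = {\<Inter>\<T> | \<T>. finite \<T> \<and> \<T> \<subseteq> \<S>}"
  have "\<Inter>\<T> \<in> \<LL>" if "finite \<T>" "\<T> \<subseteq> \<S>" for \<T>
    using that by induction (use L sub in \<open>auto simp: subspace_lattice_def\<close>)
  then have FL: "\<F> \<subseteq> \<LL>" by (auto simp: \<F>_def)
  then have clF: "csubspace F \<and> closed F" if "F \<in> \<F>" for F
    using that subspace_latticeD[OF L] by blast
  have "\<Inter>\<F> = \<Inter>\<S>"
  proof
    have "S \<in> \<F>" if "S \<in> \<S>" for S
      using that by (auto simp: \<F>_def intro!: exI[of _ "{S}"])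
    then show "\<Inter>\<F> \<subseteq> \<Inter>\<S>" by blast
    show "\<Inter>\<S> \<subseteq> \<Inter>\<F>" by (auto simp: \<F>_def)
  qed
  have ne: "\<F> \<noteq> {}" by (auto simp: \<F>_def)
  have dir: "\<exists>H\<in>\<F>. H \<subseteq> F \<and> H \<subseteq> G" if "F \<in> \<F>" "G \<in> \<F>" for F G
  proof -
    obtain \<T> where T: "F = \<Inter>\<T>" "finite \<T>" "\<T> \<subseteq> \<S>" using \<open>F \<in> \<F>\<close> by (auto simp: \<F>_def)
    obtain \<U> where U: "G = \<Inter>\<U>" "finite \<U>" "\<U> \<subseteq> \<S>" using \<open>G \<in> \<F>\<close> by (auto simp: \<F>_def)
    have "\<Inter>(\<T> \<union> \<U>) \<in> \<F>"
      unfolding \<F>_def using T U by (intro CollectI exI[of _ "\<T> \<union> \<U>"]) simp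
    then show ?thesis unfolding T U by (rule bexI[rotated]) blast
  qed
  define J where "J = join (perp ` \<F>)"
  have J: "csubspace J" "closed J" unfolding J_def by (rule closed_csubspace_join)+
  have "perp J \<in> \<LL>"
  proof (rule in_lattice_of_strong_approx[OF L closed_csubspace_perp])
    fix X :: "'a set" and e :: real assume X: "finite X" "e > 0"
    have "\<exists>H\<in>perp ` \<F>. \<forall>x\<in>X. norm (proj J x - proj H x) < e"
      unfolding J_def
    proof (rule proj_directed_approx)
      fix H K assume "H \<in> perp ` \<F>" "K \<in> perp ` \<F>"
      then obtain F G where FG: "F \<in> \<F>" "H = perp F" "G \<in> \<F>" "K = perp G" by blast
      then obtain E where "E \<in> \<F>" "E \<subseteq> F" "E \<subseteq> G" using dir by blast
      then show "\<exists>M\<in>perp ` \<F>. H \<subseteq> M \<and> K \<subseteq> M"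
        unfolding FG by (intro bexI[of _ "perp E"]) (auto simp: perp_def)
    qed (use X ne closed_csubspace_perp in auto)
    then obtain F where F: "F \<in> \<F>" "\<forall>x\<in>X. norm (proj J x - proj (perp F) x) < e" by blast
    have "norm (proj (perp J) x - proj F x) = norm (proj J x - proj (perp F) x)" for x
      using clF[OF F(1)] J by (simp add: proj_perp norm_minus_commute algebra_simps)
    then show "\<exists>F\<in>\<LL>. \<forall>x\<in>X. norm (proj (perp J) x - proj F x) < e"
      using F FL by (intro bexI[of _ F]) auto
  qed
  then show ?thesis
    using perp_join_perp[of \<F>] clF \<open>\<Inter>\<F> = \<Inter>\<S>\<close> by (simp add: J_def)
qed


section \<open>Complete distributivity and commutativity\<close>

text \<open>Apply the first distributive law to all families \<open>\<S>\<close> whose join dominates \<open>E\<close>: the meet of these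
  joins is above \<open>E\<close>. For a choice function \<open>\<phi>\<close> let \<open>N\<close> be the meet of the chosen elements. If \<open>E\<close>
  were below \<open>N\<^sub>-\<close>, then the family of all \<open>K\<close> not above \<open>N\<close> would be one of the \<open>\<S>\<close>, and \<open>\<phi>\<close> would
  choose from it an element above \<open>N\<close>, which is absurd.\<close>

lemma join_not_le_lower:
  assumes L: "subspace_lattice \<LL>" and cd: "completely_distributive \<LL>" and E: "E \<in> \<LL>"
  shows "E \<subseteq> join {N \<in> \<LL>. \<not> E \<subseteq> lower \<LL> N}"
proof -
  define I where "I = {\<S>. \<S> \<subseteq> \<LL> \<and> E \<subseteq> join \<S>}"
  have "(\<Inter>\<alpha>\<in>I. join ((\<lambda>\<beta>. \<beta>) ` \<alpha>)) = join ((\<lambda>\<phi>. \<Inter>\<alpha>\<in>I. \<phi> \<alpha>) ` Pi\<^sub>E I (\<lambda>\<alpha>. \<alpha>))"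
    using cd[unfolded completely_distributive_def, rule_format, of I "\<lambda>\<alpha>. \<alpha>" "\<lambda>\<beta> \<alpha>. \<beta>",
        THEN conjunct1] by (auto simp: I_def)
  moreover have "E \<subseteq> (\<Inter>\<alpha>\<in>I. join ((\<lambda>\<beta>. \<beta>) ` \<alpha>))" by (auto simp: I_def)
  moreover have "(\<lambda>\<phi>. \<Inter>\<alpha>\<in>I. \<phi> \<alpha>) ` Pi\<^sub>E I (\<lambda>\<alpha>. \<alpha>) \<subseteq> {N \<in> \<LL>. \<not> E \<subseteq> lower \<LL> N}"
  proof safe
    fix \<phi> assume \<phi>: "\<phi> \<in> Pi\<^sub>E I (\<lambda>\<alpha>. \<alpha>)"
    have "\<phi> ` I \<subseteq> \<LL>" using \<phi> by (auto simp: I_def PiE_def Pi_def)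
    then show "(\<Inter>\<alpha>\<in>I. \<phi> \<alpha>) \<in> \<LL>" by (rule Inter_in_lattice[OF L])
    assume "E \<subseteq> lower \<LL> (\<Inter>\<alpha>\<in>I. \<phi> \<alpha>)"
    then have *: "{K \<in> \<LL>. \<not> (\<Inter>\<alpha>\<in>I. \<phi> \<alpha>) \<subseteq> K} \<in> I"
      by (auto simp: I_def lower_def)
    from PiE_mem[OF \<phi> *] show False using * by blast
  qed
  ultimately show ?thesis using join_mono by (metis (no_types, lifting) order_trans)
qed

lemma le_of_not_le_lower:
  assumes "E \<in> \<LL>" "\<not> E \<subseteq> lower \<LL> N"
  shows "N \<subseteq> E"
  using assms join_upper[of E "{K \<in> \<LL>. \<not> N \<subseteq> K}"] unfolding lower_def by blast

text \<open>In a completely distributive lattice every element is the join of the elements \<open>K\<close> below it for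
  which the algebra contains nonzero operators \<open>x \<otimes> f\<^sup>*\<close> with \<open>x \<in> K\<close> and \<open>f\<close> orthogonal to \<open>K\<^sub>-\<close>. This
  form lets properties of such \<open>K\<close> pass to all elements.\<close>

lemma lattice_element_subsetI:
  assumes L: "subspace_lattice \<LL>" and cd: "completely_distributive \<LL>" and E: "E \<in> \<LL>"
    and T: "csubspace T" "closed T"
    and sub: "\<And>K. K \<in> \<LL> \<Longrightarrow> K \<subseteq> E \<Longrightarrow> K \<noteq> {0} \<Longrightarrow> lower \<LL> K \<noteq> UNIV \<Longrightarrow> K \<subseteq> T"
  shows "E \<subseteq> T"
proof -
  have "join {N \<in> \<LL>. \<not> E \<subseteq> lower \<LL> N} \<subseteq> T"
  proof (rule join_least[OF T])
    fix K assume "K \<in> {N \<in> \<LL>. \<not> E \<subseteq> lower \<LL> N}"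
    then show "K \<subseteq> T"
      using sub[of K] le_of_not_le_lower[OF E, of K] complex_vector.subspace_0[OF T(1)] by auto
  qed
  then show ?thesis using join_not_le_lower[OF L cd E] by blast
qed

lemma commutative_lattice_proj_image:
  assumes L: "subspace_lattice \<LL>" and comm: "commutative_lattice \<LL>" and "E \<in> \<LL>" "F \<in> \<LL>"
  shows "proj E ` F \<subseteq> F"
proof safe
  fix y assume "y \<in> F"
  then have "proj E y = proj E (proj F y)"
    using proj_id subspace_latticeD[OF L \<open>F \<in> \<LL>\<close>] by metis
  also have "\<dots> = proj F (proj E y)"
    using comm assms(3,4) unfolding commutative_lattice_def by (metis comp_apply)
  finally show "proj E y \<in> F" using proj_in[OF subspace_latticeD[OF L \<open>F \<in> \<LL>\<close>]] by metis
qed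

lemma image_join_subset:
  fixes A :: "'a::chilbert_space \<Rightarrow> 'a"
  assumes A: "A \<in> bounded_ops UNIV" and inv: "\<And>K. K \<in> \<S> \<Longrightarrow> A ` K \<subseteq> K"
  shows "A ` join \<S> \<subseteq> join \<S>"
proof -
  have lin: "A (x + y) = A x + A y" "A (c *\<^sub>C x) = c *\<^sub>C A x" for c x y
    using A by (auto simp: bounded_ops_def clinear_on_def)
  obtain c where c: "\<And>x. norm (A x) \<le> c * norm x" using A by (auto simp: bounded_ops_def)
  have "bounded_linear A"
    by (rule bounded_linear_intro[where K = c]) (auto simp: lin scaleR_scaleC c mult.commute)
  have "join \<S> \<subseteq> A -` join \<S>"
  proof (rule join_least)
    show "csubspace (A -` join \<S>)"
      by (rule complex_vector.subspaceI)
        (auto simp: lin linear_0[OF bounded_linear.linear[OF \<open>bounded_linear A\<close>]]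
          intro: complex_vector.subspace_0 complex_vector.subspace_add
            complex_vector.subspace_scale closed_csubspace_join)
    show "closed (A -` join \<S>)"
      using \<open>bounded_linear A\<close>
      by (intro continuous_closed_vimage linear_continuous_at closed_csubspace_join)
    show "K \<subseteq> A -` join \<S>" if "K \<in> \<S>" for K
      using inv[OF that] join_upper[OF that] by blast
  qed
  then show ?thesis by blast
qed


section \<open>Operators of rank one\<close>

text \<open>The scalar has to be nonzero in order that this be an equivalence relation on all vectors,
  with \<open>0\<close> in a class of its own.\<close>

definition parallel :: "'a::chilbert_space \<Rightarrow> 'a \<Rightarrow> bool" where
  "parallel x y \<longleftrightarrow> (\<exists>c. c \<noteq> 0 \<and> y = c *\<^sub>C x)"

lemma parallel_refl: "parallel x x"
  unfolding parallel_def by (intro exI[of _ 1]) (simp add: scaleC_one)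

lemma parallel_sym: "parallel x y \<Longrightarrow> parallel y x"
  unfolding parallel_def
  by (metis scaleC_scaleC scaleC_one field_class.field_inverse inverse_nonzero_iff_nonzero)

lemma parallel_trans: "parallel x y \<Longrightarrow> parallel y z \<Longrightarrow> parallel x z"
  unfolding parallel_def by (metis scaleC_scaleC mult_eq_0_iff)

lemma parallel_scaleC: "c *\<^sub>C x \<noteq> 0 \<Longrightarrow> parallel x (c *\<^sub>C x)"
  unfolding parallel_def by (metis complex_vector.scale_zero_left)

lemma rank_one_apply: "rank_one x f h = cinner h f *\<^sub>C x"
  by (simp add: rank_one_def)

lemma rank_one_add_left: "rank_one (x + y) f = (\<lambda>h. rank_one x f h + rank_one y f h)"
  by (simp add: rank_one_def scaleC_add_right)

lemma rank_one_add_right: "rank_one x (f + g) = (\<lambda>h. rank_one x f h + rank_one x g h)"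
  by (simp add: rank_one_def cinner_add_right scaleC_add_left)

lemma rank_one_scaleC_left: "rank_one (c *\<^sub>C x) f = (\<lambda>h. c *\<^sub>C rank_one x f h)"
  by (simp add: rank_one_def scaleC_scaleC mult.commute)

lemma rank_one_scaleC_right: "rank_one x (c *\<^sub>C f) = (\<lambda>h. cnj c *\<^sub>C rank_one x f h)"
  by (simp add: rank_one_def scaleC_scaleC cinner_scaleC_right)

lemma rank_one_zero [simp]: "rank_one 0 f = (\<lambda>h. 0)" "rank_one x 0 = (\<lambda>h. 0)"
  by (simp_all add: rank_one_def)

lemma rank_one_cancel_left:
  assumes "x \<noteq> 0" "rank_one x f = rank_one x g"
  shows "f = g"
proof -
  have "cinner (f - g) f = cinner (f - g) g"
    using fun_cong[OF assms(2), of "f - g"] assms(1) by (simp add: rank_one_apply)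
  then have "cinner (f - g) (f - g) = 0" by (simp add: cinner_diff_right)
  then show ?thesis by simp
qed

lemma rank_one_cancel_right:
  assumes "f \<noteq> 0" "rank_one x f = rank_one y f"
  shows "x = y"
  using fun_cong[OF assms(2), of f] assms(1) by (simp add: rank_one_apply)

lemma rank_one_eq_parallel:
  assumes eq: "rank_one u v = rank_one u' v'" and nz: "u \<noteq> 0" "v \<noteq> 0"
  shows "parallel u u'" "parallel v v'"
proof -
  have "cinner v v *\<^sub>C u = cinner v v' *\<^sub>C u'"
    using fun_cong[OF eq, of v] by (simp add: rank_one_apply)
  moreover from this have "cinner v v' \<noteq> 0" using nz by auto
  ultimately have "u' = (cinner v v / cinner v v') *\<^sub>C u"
    by (metis (no_types) complex_vector.scale_left_imp_eq complex_vector.scale_scale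
        nonzero_mult_div_cancel_left times_divide_eq_right)
  moreover have "cinner v v / cinner v v' \<noteq> 0" using nz \<open>cinner v v' \<noteq> 0\<close> by simp
  ultimately obtain c where c: "c \<noteq> 0" "u' = c *\<^sub>C u" by blast
  then show "parallel u u'" unfolding parallel_def by blast
  have "rank_one u v = rank_one u (cnj c *\<^sub>C v')"
    unfolding eq c(2) by (simp add: rank_one_scaleC_left rank_one_scaleC_right)
  then have "v = cnj c *\<^sub>C v'" by (rule rank_one_cancel_left[OF nz(1)])
  then show "parallel v v'" using nz(2) parallel_scaleC parallel_sym by blast
qed

lemma rank_one_parallel:
  assumes "parallel a u" "parallel b v"
  shows "\<exists>c. rank_one u v = rank_one (c *\<^sub>C a) b"
proof -
  obtain c d where "u = c *\<^sub>C a" "v = d *\<^sub>C b" using assms by (auto simp: parallel_def)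
  then show ?thesis
    by (intro exI[of _ "c * cnj d"])
      (simp add: rank_one_scaleC_left rank_one_scaleC_right scaleC_scaleC mult.commute)
qed

lemma separating_vector:
  assumes "f \<noteq> 0" "g \<noteq> 0" "\<not> parallel f g"
  shows "\<exists>h. cinner h f = 0 \<and> cinner h g \<noteq> 0"
proof -
  define c where "c = cinner g f / cinner f f"
  define h where "h = g - c *\<^sub>C f"
  have hf: "cinner h f = 0"
    using assms(1) by (simp add: h_def c_def cinner_diff_left cinner_scaleC_left)
  then have "cinner h g = cinner h h"
    by (simp add: h_def cinner_diff_right[of _ g] cinner_scaleC_right)
  moreover have "h \<noteq> 0"
    using assms parallel_scaleC[of c f] by (auto simp: h_def)
  ultimately show ?thesis using hf by auto
qed

text \<open>If the second factors are not parallel, then a vector orthogonal to one of them but not to the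
  other shows that each first factor is a multiple of \<open>w\<close>.\<close>

lemma rank_one_sum_parallel:
  assumes eq: "(\<lambda>h. rank_one u v h + rank_one u' v' h) = rank_one w z"
    and nz: "u \<noteq> 0" "v \<noteq> 0" "u' \<noteq> 0" "v' \<noteq> 0"
  shows "parallel u u' \<or> parallel v v'"
proof (rule disjCI)
  assume np: "\<not> parallel v v'"
  have *: "parallel w u2"
    if "cinner h v1 = 0" "cinner h v2 \<noteq> 0" "u2 \<noteq> 0"
      and eq: "cinner h v1 *\<^sub>C u1 + cinner h v2 *\<^sub>C u2 = cinner h z *\<^sub>C w" for h u1 v1 u2 v2
  proof -
    have "cinner h v2 *\<^sub>C u2 = cinner h z *\<^sub>C w" using that(1) eq by simp
    then have "u2 = (cinner h z / cinner h v2) *\<^sub>C w"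
      using that(2) by (metis (no_types) complex_vector.scale_left_imp_eq complex_vector.scale_scale
        nonzero_mult_div_cancel_left times_divide_eq_right)
    then show ?thesis using that(3) parallel_scaleC by blast
  qed
  have at: "cinner h v *\<^sub>C u + cinner h v' *\<^sub>C u' = cinner h z *\<^sub>C w" for h
    using fun_cong[OF eq, of h] by (simp add: rank_one_apply)
  obtain h where "cinner h v = 0" "cinner h v' \<noteq> 0" using separating_vector nz np by blast
  then have "parallel w u'" using *[OF _ _ nz(3) at] by blast
  moreover obtain k where "cinner k v' = 0" "cinner k v \<noteq> 0"
    using separating_vector nz np parallel_sym by blast
  then have "parallel w u" using *[of k v' v u u'] at[of k] nz(1) by (simp add: add.commute)
  ultimately show "parallel u u'" using parallel_trans parallel_sym by blast
qed

lemma parallel_rank_one_sum: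
  assumes "parallel u u' \<or> parallel v v'"
  shows "\<exists>w z. (\<lambda>h. rank_one u v h + rank_one u' v' h) = rank_one w z"
  using assms
proof
  assume "parallel u u'"
  then obtain c where "u' = c *\<^sub>C u" by (auto simp: parallel_def)
  then have "(\<lambda>h. rank_one u v h + rank_one u' v' h) = rank_one u (v + cnj c *\<^sub>C v')"
    by (simp add: rank_one_add_right rank_one_scaleC_left rank_one_scaleC_right)
  then show ?thesis by blast
next
  assume "parallel v v'"
  then obtain c where "v' = c *\<^sub>C v" by (auto simp: parallel_def)
  then have "(\<lambda>h. rank_one u v h + rank_one u' v' h) = rank_one (u + cnj c *\<^sub>C u') v"
    by (simp add: rank_one_add_left rank_one_scaleC_left rank_one_scaleC_right)
  then show ?thesis by blast
qed

lemma cinner_rank_one_adjoint: "cinner (rank_one u v h) k = cinner h (rank_one v u k)"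
  using cinner_commute[of k u]
  by (simp add: rank_one_apply cinner_scaleC_left cinner_scaleC_right mult.commute)

lemma eq_of_cinner_eq:
  assumes "\<And>h. cinner h x = cinner h y"
  shows "x = y"
proof -
  have "cinner (x - y) (x - y) = 0" using assms[of "x - y"] by (simp add: cinner_diff_right)
  then show ?thesis by simp
qed

lemma rank_one_adjoint_add:
  assumes "rank_one u v = (\<lambda>h. rank_one u1 v1 h + rank_one u2 v2 h)"
  shows "rank_one v u = (\<lambda>h. rank_one v1 u1 h + rank_one v2 u2 h)"
  by (rule ext, rule eq_of_cinner_eq)
     (simp add: cinner_rank_one_adjoint[symmetric] cinner_add_right assms cinner_add_left)

lemma rank_one_adjoint_scaleC:
  assumes "rank_one u v = (\<lambda>h. c *\<^sub>C rank_one u1 v1 h)"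
  shows "rank_one v u = (\<lambda>h. cnj c *\<^sub>C rank_one v1 u1 h)"
  by (rule ext, rule eq_of_cinner_eq)
     (simp add: cinner_rank_one_adjoint[symmetric] cinner_scaleC_right assms cinner_scaleC_left)

lemma rank_one_adjoint: "rank_one u v = rank_one u1 v1 \<Longrightarrow> rank_one v u = rank_one v1 u1"
  using rank_one_adjoint_scaleC[of u v 1] by (simp add: scaleC_one)

lemma range_rank_one: "range (rank_one u v) \<subseteq> cspan {u}"
  by (auto simp: rank_one_apply complex_vector.span_singleton)

lemma rank_one_in_range: "v \<noteq> 0 \<Longrightarrow> u \<in> range (rank_one u v)"
  by (rule range_eqI[of _ _ "(1 / cinner v v) *\<^sub>C v"])
     (simp add: rank_one_apply cinner_scaleC_left scaleC_one)

lemma finite_rank_rank_one: "finite_rank (rank_one u v)"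
  unfolding finite_rank_def using range_rank_one by blast

lemma rank_op_rank_one_le: "rank_op (rank_one u v) \<le> 1"
  unfolding rank_op_def using complex_vector.dim_le_card[OF range_rank_one, of u v] by simp

lemma rank_op_rank_one:
  assumes "u \<noteq> 0" "v \<noteq> 0"
  shows "rank_op (rank_one u v) = 1"
  unfolding rank_op_def
  by (rule complex_vector.dim_unique[OF _ range_rank_one])
     (use assms rank_one_in_range in auto)

lemma finite_rank_rank_one_sum: "finite_rank (\<lambda>h. rank_one u v h + rank_one u' v' h)"
  unfolding finite_rank_def
  by (rule exI[of _ "{u, u'}"])
     (auto simp: rank_one_apply intro!: complex_vector.span_add complex_vector.span_scale
       intro: complex_vector.span_base)

lemma independent_of_not_parallel:
  assumes "x \<noteq> 0" "y \<noteq> 0" "\<not> parallel x y"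
  shows "complex_vector.independent {x, y}"
proof -
  have "x \<notin> cspan {y}"
  proof
    assume "x \<in> cspan {y}"
    then obtain c where "x = c *\<^sub>C y" by (auto simp: complex_vector.span_singleton)
    then show False using assms parallel_scaleC parallel_sym by blast
  qed
  then show ?thesis
    using assms(2) by (auto simp: complex_vector.independent_insert)
qed

lemma rank_op_rank_one_sum:
  assumes x: "x \<noteq> 0" "y \<noteq> 0" "\<not> parallel x y" and f: "f \<noteq> 0" "g \<noteq> 0" "\<not> parallel f g"
  shows "rank_op (\<lambda>h. rank_one x f h + rank_one y g h) = 2"
  unfolding rank_op_def
proof (rule complex_vector.dim_unique)
  let ?A = "\<lambda>h. rank_one x f h + rank_one y g h"
  have scale: "c *\<^sub>C ?A h = ?A (c *\<^sub>C h)" for c h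
    by (simp add: rank_one_apply cinner_scaleC_left scaleC_add_right scaleC_scaleC)
  have *: "w \<in> range ?A" if "?A h = c *\<^sub>C w" "c \<noteq> 0" for h c w
    using that scale[of "inverse c" h]
    by (metis (no_types, lifting) field_class.field_inverse rangeI scaleC_one scaleC_scaleC)
  obtain h where h: "cinner h f = 0" "cinner h g \<noteq> 0" using separating_vector f by blast
  obtain k where k: "cinner k g = 0" "cinner k f \<noteq> 0"
    using separating_vector f parallel_sym by blast
  show "{x, y} \<subseteq> range ?A"
    using *[of k "cinner k f" x] *[of h "cinner h g" y] h k by (simp add: rank_one_apply)
  show "range ?A \<subseteq> cspan {x, y}"
    by (auto simp: rank_one_apply intro!: complex_vector.span_add complex_vector.span_scale
       intro: complex_vector.span_base)
  show "complex_vector.independent {x, y}" by (rule independent_of_not_parallel[OF x])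
  have "x \<noteq> y" using x parallel_refl by blast
  then show "card {x, y} = 2" by simp
qed

text \<open>If \<open>A\<close> has one-dimensional range and \<open>v\<close> spans the orthogonal complement of its kernel, then
  \<open>A h\<close> is proportional to \<open>A v\<close>, and the factor is read off from \<open>\<langle>h, v\<rangle>\<close>.\<close>

lemma bounded_op_rank_one:
  fixes A :: "'a::chilbert_space \<Rightarrow> 'a"
  assumes A: "A \<in> bounded_ops UNIV" and rk: "rank_op A = 1"
  shows "\<exists>u v. u \<noteq> 0 \<and> v \<noteq> 0 \<and> A = rank_one u v"
proof -
  have lin: "A (x + y) = A x + A y" "A (c *\<^sub>C x) = c *\<^sub>C A x" for c x y
    using A by (auto simp: bounded_ops_def clinear_on_def)
  obtain c where c: "\<And>x. norm (A x) \<le> c * norm x" using A by (auto simp: bounded_ops_def)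
  have bl: "bounded_linear A"
    by (rule bounded_linear_intro[where K = c]) (auto simp: lin scaleR_scaleC c mult.commute)
  have A0: "A 0 = 0" using linear_0[OF bounded_linear.linear[OF bl]] .
  have Adiff: "A (x - y) = A x - A y" for x y
    using linear_diff[OF bounded_linear.linear[OF bl]] .
  obtain B where B: "B \<subseteq> range A" "complex_vector.independent B" "range A \<subseteq> cspan B"
      "card B = cdim (range A)"
    using complex_vector.basis_exists by blast
  then obtain w where w: "B = {w}" using rk by (metis rank_op_def card_1_singletonE)
  then have "w \<noteq> 0" using B(2) complex_vector.dependent_zero by blast
  have "\<exists>c. A h = c *\<^sub>C w" for h
    using B(3) by (auto simp: w complex_vector.span_singleton)
  then obtain \<phi> where \<phi>: "\<And>h. A h = \<phi> h *\<^sub>C w" by metis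
  define K where "K = A -` {0}"
  have K: "csubspace K" "closed K"
  proof -
    show "csubspace K" by (rule complex_vector.subspaceI) (auto simp: K_def lin A0)
    show "closed K" unfolding K_def
      using bl by (intro continuous_closed_vimage linear_continuous_at) auto
  qed
  have "K \<noteq> UNIV" using B(1) w \<open>w \<noteq> 0\<close> by (auto simp: K_def)
  then have "perp K \<noteq> {0}" using perp_eq_0_iff[OF K] by blast
  then obtain v where v: "v \<in> perp K" "v \<noteq> 0"
    using complex_vector.subspace_0[OF closed_csubspace_perp(1), of K] by blast
  have "v \<notin> K" using v in_perp_both_eq_0 by blast
  then have "A v \<noteq> 0" by (simp add: K_def)
  have "A h = rank_one ((1 / cinner v v) *\<^sub>C A v) v h" for h
  proof -
    have "A (\<phi> v *\<^sub>C h - \<phi> h *\<^sub>C v) = 0"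
      by (simp add: Adiff lin \<phi>[of h] \<phi>[of v] scaleC_scaleC mult.commute)
    then have "cinner (\<phi> v *\<^sub>C h - \<phi> h *\<^sub>C v) v = 0"
      using v(1) cinner_eq_0_commute by (auto simp: perp_def K_def)
    then have "\<phi> h = \<phi> v * cinner h v / cinner v v"
      using v(2) by (simp add: cinner_diff_left cinner_scaleC_left field_simps)
    then show ?thesis
      using \<phi>[of h] \<phi>[of v] by (simp add: rank_one_apply scaleC_scaleC mult.commute)
  qed
  moreover have "(1 / cinner v v) *\<^sub>C A v \<noteq> 0" using \<open>A v \<noteq> 0\<close> v(2) by simp
  ultimately show ?thesis using v(2) by blast
qed


section \<open>Sesquilinear families of operators of rank one\<close>

text \<open>A family of operators \<open>u x f \<otimes> (v x f)\<^sup>*\<close> whose dependence on \<open>x\<close> is additive and homogeneous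
  up to \<open>\<sigma>\<close>, and likewise in \<open>f\<close> with the conjugate factor. The parameter \<open>\<sigma>\<close> is the identity for the
  family itself and complex conjugation for the family of the adjoints, so that a statement about
  ranges also yields the one about kernels.\<close>

locale rank_one_family =
  fixes X Y :: "'a::chilbert_space set" and \<sigma> :: "complex \<Rightarrow> complex"
    and u v :: "'a \<Rightarrow> 'a \<Rightarrow> 'a"
  assumes X: "csubspace X" and Y: "csubspace Y" and surj_\<sigma>: "surj \<sigma>"
    and add_left: "x \<in> X \<Longrightarrow> y \<in> X \<Longrightarrow> f \<in> Y \<Longrightarrow> rank_one (u (x + y) f) (v (x + y) f) =
          (\<lambda>h. rank_one (u x f) (v x f) h + rank_one (u y f) (v y f) h)"
    and add_right: "x \<in> X \<Longrightarrow> f \<in> Y \<Longrightarrow> g \<in> Y \<Longrightarrow> rank_one (u x (f + g)) (v x (f + g)) =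
          (\<lambda>h. rank_one (u x f) (v x f) h + rank_one (u x g) (v x g) h)"
    and scale_left: "x \<in> X \<Longrightarrow> f \<in> Y \<Longrightarrow> rank_one (u (c *\<^sub>C x) f) (v (c *\<^sub>C x) f) =
          (\<lambda>h. \<sigma> c *\<^sub>C rank_one (u x f) (v x f) h)"
    and scale_right: "x \<in> X \<Longrightarrow> f \<in> Y \<Longrightarrow> rank_one (u x (c *\<^sub>C f)) (v x (c *\<^sub>C f)) =
          (\<lambda>h. cnj (\<sigma> c) *\<^sub>C rank_one (u x f) (v x f) h)"
    and nonzero: "x \<in> X \<Longrightarrow> x \<noteq> 0 \<Longrightarrow> f \<in> Y \<Longrightarrow> f \<noteq> 0 \<Longrightarrow> u x f \<noteq> 0 \<and> v x f \<noteq> 0"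
begin

lemma adjoint_family: "rank_one_family X Y (\<lambda>c. cnj (\<sigma> c)) v u"
proof
  show "surj (\<lambda>c. cnj (\<sigma> c))"
    using surj_\<sigma> by (metis complex_cnj_cnj surj_def)
qed (use X Y nonzero in \<open>auto intro: rank_one_adjoint_add[OF add_left]
      rank_one_adjoint_add[OF add_right] rank_one_adjoint_scaleC[OF scale_left]
      rank_one_adjoint_scaleC[OF scale_right, simplified]\<close>)

lemma zero_left: "f \<in> Y \<Longrightarrow> rank_one (u 0 f) (v 0 f) = (\<lambda>h. 0)"
  using add_left[of 0 0 f] complex_vector.subspace_0[OF X] by (simp add: fun_eq_iff)

lemma zero_right: "x \<in> X \<Longrightarrow> rank_one (u x 0) (v x 0) = (\<lambda>h. 0)"
  using add_right[of x 0 0] complex_vector.subspace_0[OF Y] by (simp add: fun_eq_iff)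

text \<open>Fixing one argument gives candidates for \<open>U\<close> and \<open>V\<close>. They reproduce the family up to a scalar
  depending on \<open>x\<close> and \<open>f\<close>; comparing \<open>x\<close>, \<open>x\<^sub>0\<close> and \<open>x + x\<^sub>0\<close> shows that this scalar is \<open>1\<close>.\<close>

lemma factorization:
  assumes ne: "X \<noteq> {0}" "Y \<noteq> {0}"
    and u_par: "\<And>x f g. x \<in> X - {0} \<Longrightarrow> f \<in> Y - {0} \<Longrightarrow> g \<in> Y - {0} \<Longrightarrow> parallel (u x f) (u x g)"
    and v_par: "\<And>x y f. x \<in> X - {0} \<Longrightarrow> y \<in> X - {0} \<Longrightarrow> f \<in> Y - {0} \<Longrightarrow> parallel (v x f) (v y f)"
  shows "\<exists>U V. (\<forall>x\<in>X. \<forall>y\<in>X. U (x + y) = U x + U y) \<and> (\<forall>c. \<forall>x\<in>X. U (c *\<^sub>C x) = \<sigma> c *\<^sub>C U x) \<and>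
    (\<forall>f\<in>Y. \<forall>g\<in>Y. V (f + g) = V f + V g) \<and> (\<forall>c. \<forall>f\<in>Y. V (c *\<^sub>C f) = \<sigma> c *\<^sub>C V f) \<and>
    (\<forall>x\<in>X. \<forall>f\<in>Y. rank_one (u x f) (v x f) = rank_one (U x) (V f))"
proof -
  obtain x0 f0 where x0: "x0 \<in> X" "x0 \<noteq> 0" and f0: "f0 \<in> Y" "f0 \<noteq> 0"
    using ne complex_vector.subspace_0[OF X] complex_vector.subspace_0[OF Y] by blast
  define u0 where "u0 = u x0 f0"
  define v0 where "v0 = v x0 f0"
  have u0: "u0 \<noteq> 0" and v0: "v0 \<noteq> 0" using nonzero x0 f0 by (auto simp: u0_def v0_def)
  have "\<exists>a. rank_one (u x f0) (v x f0) = rank_one a v0" if "x \<in> X" for x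
  proof (cases "x = 0")
    case True
    then show ?thesis using zero_left f0 by (auto intro!: exI[of _ 0])
  next
    case False
    then have "parallel v0 (v x f0)" using v_par[of x0 x f0] x0 f0 that by (simp add: v0_def)
    from rank_one_parallel[OF parallel_refl this] show ?thesis by blast
  qed
  then obtain U where U: "\<And>x. x \<in> X \<Longrightarrow> rank_one (u x f0) (v x f0) = rank_one (U x) v0" by metis
  have "\<exists>b. rank_one (u x0 f) (v x0 f) = rank_one u0 b" if "f \<in> Y" for f
  proof (cases "f = 0")
    case True
    then show ?thesis using zero_right x0 by (auto intro!: exI[of _ 0])
  next
    case False
    then have "parallel u0 (u x0 f)" using u_par[of x0 f0 f] x0 f0 that by (simp add: u0_def)
    then obtain c where "rank_one (u x0 f) (v x0 f) = rank_one (c *\<^sub>C u0) (v x0 f)"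
      using rank_one_parallel[OF _ parallel_refl] by blast
    then have "rank_one (u x0 f) (v x0 f) = rank_one u0 (cnj c *\<^sub>C v x0 f)"
      by (simp add: rank_one_scaleC_left rank_one_scaleC_right)
    then show ?thesis by blast
  qed
  then obtain V where V: "\<And>f. f \<in> Y \<Longrightarrow> rank_one (u x0 f) (v x0 f) = rank_one u0 (V f)" by metis
  have U_add: "U (x + y) = U x + U y" if "x \<in> X" "y \<in> X" for x y
    using add_left[OF that f0(1)] U that complex_vector.subspace_add[OF X that]
    by (intro rank_one_cancel_right[OF v0]) (simp add: rank_one_add_left)
  have U_scale: "U (c *\<^sub>C x) = \<sigma> c *\<^sub>C U x" if "x \<in> X" for c x
    using scale_left[OF that f0(1)] U that complex_vector.subspace_scale[OF X that]
    by (intro rank_one_cancel_right[OF v0]) (simp add: rank_one_scaleC_left)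
  have V_add: "V (f + g) = V f + V g" if "f \<in> Y" "g \<in> Y" for f g
    using add_right[OF x0(1) that] V that complex_vector.subspace_add[OF Y that]
    by (intro rank_one_cancel_left[OF u0]) (simp add: rank_one_add_right)
  have V_scale: "V (c *\<^sub>C f) = \<sigma> c *\<^sub>C V f" if "f \<in> Y" for c f
    using scale_right[OF x0(1) that] V that complex_vector.subspace_scale[OF Y that]
    by (intro rank_one_cancel_left[OF u0]) (simp add: rank_one_scaleC_right)
  have Ux0: "U x0 = u0"
    using U[OF x0(1)] rank_one_cancel_right[OF v0] by (simp add: u0_def v0_def)
  have U_nz: "U x \<noteq> 0" if "x \<in> X" "x \<noteq> 0" for x
  proof
    assume "U x = 0"
    then have "rank_one (u x f0) (v x f0) (v x f0) = 0" using U[OF that(1)] by simp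
    then show False using nonzero[OF that f0] by (simp add: rank_one_apply)
  qed
  have scalar: "\<exists>c. rank_one (u x f) (v x f) = rank_one (c *\<^sub>C U x) (V f)"
    if x: "x \<in> X" "x \<noteq> 0" and f: "f \<in> Y" "f \<noteq> 0" for x f
  proof (rule rank_one_parallel)
    have "parallel (u x f0) (U x)"
      using rank_one_eq_parallel[OF U[OF x(1)]] nonzero[OF x f0] by blast
    then show "parallel (U x) (u x f)"
      using u_par[of x f0 f] x f f0 parallel_trans parallel_sym by blast
    have "parallel (v x0 f) (V f)"
      using rank_one_eq_parallel[OF V[OF f(1)]] nonzero[OF x0 f] by blast
    then show "parallel (V f) (v x f)"
      using v_par[of x0 x f] x f x0 parallel_trans parallel_sym by blast
  qed
  have main: "rank_one (u x f) (v x f) = rank_one (U x) (V f)" if x: "x \<in> X" and f: "f \<in> Y" for x f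
  proof -
    consider "f = 0" | a where "f \<noteq> 0" "x = a *\<^sub>C x0" | "f \<noteq> 0" "x \<noteq> 0" "\<nexists>a. x = a *\<^sub>C x0"
      by (metis complex_vector.scale_zero_left)
    then show ?thesis
    proof cases
      case 1
      then have "V f = 0" using V_add[OF f f] by simp
      then show ?thesis using 1 zero_right[OF x] by simp
    next
      case 2
      have "rank_one (u x f) (v x f) = (\<lambda>h. \<sigma> a *\<^sub>C rank_one u0 (V f) h)"
        unfolding 2 scale_left[OF x0(1) f] V[OF f] ..
      then show ?thesis
        using 2(2) U_scale[OF x0(1)] Ux0 by (simp add: rank_one_scaleC_left)
    next
      case 3
      have xx0: "x + x0 \<in> X" using x x0 complex_vector.subspace_add[OF X] by blast
      have "x + x0 \<noteq> 0"
        using 3(3) by (metis add_eq_0_iff2 complex_vector.scale_minus_left scaleC_one)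
      then obtain c d where
        c: "rank_one (u x f) (v x f) = rank_one (c *\<^sub>C U x) (V f)" and
        d: "rank_one (u (x + x0) f) (v (x + x0) f) = rank_one (d *\<^sub>C U (x + x0)) (V f)"
        using scalar 3 x f xx0 by metis
      have "V f \<noteq> 0"
      proof
        assume "V f = 0"
        then have "rank_one (u x0 f) (v x0 f) (v x0 f) = 0" using V[OF f] by simp
        then show False using nonzero[OF x0 f 3(1)] by (simp add: rank_one_apply)
      qed
      moreover have "rank_one (d *\<^sub>C U (x + x0)) (V f) = rank_one (c *\<^sub>C U x + u0) (V f)"
        using d c add_left[OF x x0(1) f] V[OF f] by (simp add: rank_one_add_left)
      ultimately have "d *\<^sub>C U (x + x0) = c *\<^sub>C U x + u0" by (rule rank_one_cancel_right)
      then have eq: "(1 - d) *\<^sub>C u0 = (d - c) *\<^sub>C U x"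
        unfolding U_add[OF x x0(1)] Ux0 scaleC_add_right complex_vector.scale_left_diff_distrib
          scaleC_one by (simp add: algebra_simps)
      have "d = 1"
      proof (rule ccontr)
        assume "d \<noteq> 1"
        then have "u0 = ((d - c) / (1 - d)) *\<^sub>C U x"
          using eq by (metis (no_types) complex_vector.scale_left_imp_eq complex_vector.scale_scale
              nonzero_mult_div_cancel_left times_divide_eq_right right_minus_eq)
        \<comment> \<open>a linear relation between \<open>U x0\<close> and \<open>U x\<close> lifts to one between \<open>x0\<close> and \<open>x\<close>\<close>
        moreover obtain t where t: "\<sigma> t = - ((d - c) / (1 - d))"
          using surj_\<sigma> by (metis surj_def)
        ultimately have "U (x0 + t *\<^sub>C x) = 0"
          using U_add[OF x0(1) complex_vector.subspace_scale[OF X x], of t] U_scale[OF x, of t] Ux0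
          by simp
        then have "x0 + t *\<^sub>C x = 0"
          using U_nz complex_vector.subspace_add[OF X x0(1) complex_vector.subspace_scale[OF X x]]
          by blast
        then have "x0 = (- t) *\<^sub>C x" by (simp add: eq_neg_iff_add_eq_0)
        then have "parallel x0 x" using x0(2) parallel_scaleC parallel_sym by metis
        then show False using 3(3) by (auto simp: parallel_def)
      qed
      then have "(1 - c) *\<^sub>C U x = 0" using eq by simp
      then have "c = 1" using U_nz[OF x 3(2)] by simp
      then show ?thesis using c by (simp add: scaleC_one)
    qed
  qed
  show ?thesis
    by (intro exI[of _ U] exI[of _ V] conjI ballI allI U_add U_scale V_add V_scale main)
qed

end

text \<open>Two equivalence relations on a set that together relate any two elements cannot both be
  proper, just as a group is not the union of two proper subgroups.\<close>

lemma two_equivalences_cover: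
  assumes r: "\<And>a b. r a b \<Longrightarrow> r b a" "\<And>a b c. r a b \<Longrightarrow> r b c \<Longrightarrow> r a c"
    and k: "\<And>a b. k a b \<Longrightarrow> k b a" "\<And>a b c. k a b \<Longrightarrow> k b c \<Longrightarrow> k a c"
    and cover: "\<And>a b. a \<in> S \<Longrightarrow> b \<in> S \<Longrightarrow> r a b \<or> k a b"
  shows "(\<forall>a\<in>S. \<forall>b\<in>S. r a b) \<or> (\<forall>a\<in>S. \<forall>b\<in>S. k a b)"
proof (rule ccontr)
  assume "\<not> ?thesis"
  then obtain a b c d where abcd: "a \<in> S" "b \<in> S" "\<not> r a b" "c \<in> S" "d \<in> S" "\<not> k c d" by blast
  then have "k a b" "r c d" using cover by blast+
  then show False
    using abcd cover[of a c] cover[of a d] cover[of b c] cover[of b d] r k by metis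
qed

text \<open>For fixed \<open>x\<close> the operators \<open>u x f \<otimes> (v x f)\<^sup>*\<close> form a space without elements of rank two, so
  either all of them have the same range or all of them have the same kernel; likewise for fixed \<open>f\<close>.
  When \<open>X\<close> and \<open>Y\<close> have at least two dimensions, the choice cannot be the same for some \<open>x\<close> and some
  \<open>f\<close>, since then a sum that is excluded by \<open>rank2\<close> would have rank at most one. Hence the choice is
  \<open>range\<close> for all \<open>x\<close> and \<open>kernel\<close> for all \<open>f\<close>, or vice versa. In dimension one both alternatives
  hold for the other variable.\<close>

lemma rank_one_family_dichotomy:
  assumes fam: "rank_one_family X Y (\<lambda>c. c) u v" and ne: "X \<noteq> {0}" "Y \<noteq> {0}"
    and rank2: "\<And>x y f g w z. x \<in> X - {0} \<Longrightarrow> y \<in> X - {0} \<Longrightarrow> \<not> parallel x y \<Longrightarrow>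
      f \<in> Y - {0} \<Longrightarrow> g \<in> Y - {0} \<Longrightarrow> \<not> parallel f g \<Longrightarrow>
      (\<lambda>h. rank_one (u x f) (v x f) h + rank_one (u y g) (v y g) h) \<noteq> rank_one w z"
  shows "(\<exists>U V. clinear_on X U \<and> clinear_on Y V \<and>
            (\<forall>x\<in>X. \<forall>f\<in>Y. rank_one (u x f) (v x f) = rank_one (U x) (V f))) \<or>
         (\<exists>U V. conj_linear_on Y U \<and> conj_linear_on X V \<and>
            (\<forall>x\<in>X. \<forall>f\<in>Y. rank_one (u x f) (v x f) = rank_one (U f) (V x)))"
proof -
  interpret rank_one_family X Y "\<lambda>c. c" u v by (rule fam)
  interpret adj: rank_one_family X Y cnj v u using adjoint_family by simp
  define P where "P x \<longleftrightarrow> (\<forall>f\<in>Y-{0}. \<forall>g\<in>Y-{0}. parallel (u x f) (u x g))" for x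
  define Q where "Q x \<longleftrightarrow> (\<forall>f\<in>Y-{0}. \<forall>g\<in>Y-{0}. parallel (v x f) (v x g))" for x
  define P' where "P' f \<longleftrightarrow> (\<forall>x\<in>X-{0}. \<forall>y\<in>X-{0}. parallel (u x f) (u y f))" for f
  define Q' where "Q' f \<longleftrightarrow> (\<forall>x\<in>X-{0}. \<forall>y\<in>X-{0}. parallel (v x f) (v y f))" for f
  have PQ: "P x \<or> Q x" if x: "x \<in> X - {0}" for x
    unfolding P_def Q_def
  proof (rule two_equivalences_cover)
    fix f g assume "f \<in> Y - {0}" "g \<in> Y - {0}"
    then show "parallel (u x f) (u x g) \<or> parallel (v x f) (v x g)"
      using add_right[of x f g, symmetric] nonzero[of x] x
      by (intro rank_one_sum_parallel[where w = "u x (f + g)" and z = "v x (f + g)"]) auto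
  qed (blast intro: parallel_sym parallel_trans)+
  have PQ': "P' f \<or> Q' f" if f: "f \<in> Y - {0}" for f
    unfolding P'_def Q'_def
  proof (rule two_equivalences_cover)
    fix x y assume "x \<in> X - {0}" "y \<in> X - {0}"
    then show "parallel (u x f) (u y f) \<or> parallel (v x f) (v y f)"
      using add_left[of x y f, symmetric] nonzero[of _ f] f
      by (intro rank_one_sum_parallel[where w = "u (x + y) f" and z = "v (x + y) f"]) auto
  qed (blast intro: parallel_sym parallel_trans)+
  have par_left: "parallel (u x f) (u y f)" "parallel (v x f) (v y f)"
    if "x \<in> X - {0}" "y \<in> X - {0}" "f \<in> Y - {0}" "parallel x y" for x y f
  proof -
    obtain c where "c \<noteq> 0" "y = c *\<^sub>C x" using \<open>parallel x y\<close> by (auto simp: parallel_def)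
    then have "rank_one (u y f) (v y f) = rank_one (c *\<^sub>C u x f) (v x f)"
      using scale_left[of x f c] that by (simp add: rank_one_scaleC_left)
    from rank_one_eq_parallel[OF this] nonzero[of y f] that
    have *: "parallel (u y f) (c *\<^sub>C u x f)" "parallel (v y f) (v x f)" by auto
    have "parallel (u x f) (c *\<^sub>C u x f)" using \<open>c \<noteq> 0\<close> by (auto simp: parallel_def)
    then show "parallel (u x f) (u y f)" using parallel_trans parallel_sym * by blast
    show "parallel (v x f) (v y f)" using parallel_sym * by blast
  qed
  have par_right: "parallel (u x f) (u x g)" "parallel (v x f) (v x g)"
    if "x \<in> X - {0}" "f \<in> Y - {0}" "g \<in> Y - {0}" "parallel f g" for x f g
  proof -
    obtain c where "c \<noteq> 0" "g = c *\<^sub>C f" using \<open>parallel f g\<close> by (auto simp: parallel_def)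
    then have "rank_one (u x g) (v x g) = rank_one (cnj c *\<^sub>C u x f) (v x f)"
      using scale_right[of x f c] that by (simp add: rank_one_scaleC_left)
    from rank_one_eq_parallel[OF this] nonzero[of x g] that
    have *: "parallel (u x g) (cnj c *\<^sub>C u x f)" "parallel (v x g) (v x f)" by auto
    have "parallel (u x f) (cnj c *\<^sub>C u x f)"
      using \<open>c \<noteq> 0\<close> unfolding parallel_def by (intro exI[of _ "cnj c"]) simp
    then show "parallel (u x f) (u x g)" using parallel_trans parallel_sym * by blast
    show "parallel (v x f) (v x g)" using parallel_sym * by blast
  qed
  obtain x0 f0 where x0: "x0 \<in> X - {0}" and f0: "f0 \<in> Y - {0}"
    using ne complex_vector.subspace_0[OF X] complex_vector.subspace_0[OF Y] by blast
  have "(\<forall>x\<in>X-{0}. P x) \<and> (\<forall>f\<in>Y-{0}. Q' f) \<or> (\<forall>x\<in>X-{0}. Q x) \<and> (\<forall>f\<in>Y-{0}. P' f)"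
  proof -
    consider (X1) "\<forall>x\<in>X-{0}. \<forall>y\<in>X-{0}. parallel x y" | (Y1) "\<forall>f\<in>Y-{0}. \<forall>g\<in>Y-{0}. parallel f g"
      | (big) x1 x2 f1 f2 where "x1 \<in> X - {0}" "x2 \<in> X - {0}" "\<not> parallel x1 x2"
          "f1 \<in> Y - {0}" "f2 \<in> Y - {0}" "\<not> parallel f1 f2"
      by blast
    then show ?thesis
    proof cases
      case X1
      then have "P' f" "Q' f" if "f \<in> Y - {0}" for f
        using that par_left unfolding P'_def Q'_def by blast+
      moreover have "P x0 \<Longrightarrow> P x" "Q x0 \<Longrightarrow> Q x" if "x \<in> X - {0}" for x
      proof -
        have *: "parallel (u x f) (u x0 f)" "parallel (v x f) (v x0 f)" if "f \<in> Y - {0}" for f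
          using par_left X1 x0 \<open>x \<in> X - {0}\<close> that by blast+
        show "P x0 \<Longrightarrow> P x" "Q x0 \<Longrightarrow> Q x"
          using * parallel_trans[OF parallel_trans[OF _ _] parallel_sym] unfolding P_def Q_def
          by meson+
      qed
      ultimately show ?thesis using PQ[OF x0] by blast
    next
      case Y1
      then have "P x" "Q x" if "x \<in> X - {0}" for x
        using that par_right unfolding P_def Q_def by blast+
      moreover have "P' f0 \<Longrightarrow> P' f" "Q' f0 \<Longrightarrow> Q' f" if "f \<in> Y - {0}" for f
      proof -
        have *: "parallel (u x f) (u x f0)" "parallel (v x f) (v x f0)" if "x \<in> X - {0}" for x
          using par_right Y1 f0 \<open>f \<in> Y - {0}\<close> that by blast+
        show "P' f0 \<Longrightarrow> P' f" "Q' f0 \<Longrightarrow> Q' f"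
          using * parallel_trans[OF parallel_trans[OF _ _] parallel_sym] unfolding P'_def Q'_def
          by meson+
      qed
      ultimately show ?thesis using PQ'[OF f0] by blast
    next
      case big
      have other: "\<exists>y\<in>X-{0}. \<not> parallel x y" "\<exists>g\<in>Y-{0}. \<not> parallel f g" for x f
        using big parallel_trans[OF parallel_sym] by meson+
      have cross: "\<not> (P x \<and> P' f)" "\<not> (Q x \<and> Q' f)" if x: "x \<in> X - {0}" and f: "f \<in> Y - {0}" for x f
      proof -
        obtain y g where yg: "y \<in> X - {0}" "\<not> parallel x y" "g \<in> Y - {0}" "\<not> parallel g f"
          using other parallel_sym by meson
        have "\<not> (parallel (u x g) (u y f) \<or> parallel (v x g) (v y f))"
          using parallel_rank_one_sum[of "u x g" "u y f" "v x g" "v y f"] rank2[of x y g f] x f yg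
          by blast
        moreover have "parallel (u x g) (u x f)" if "P x"
          using that f yg unfolding P_def by blast
        moreover have "parallel (u x f) (u y f)" if "P' f"
          using that x yg unfolding P'_def by blast
        moreover have "parallel (v x g) (v x f)" if "Q x"
          using that f yg unfolding Q_def by blast
        moreover have "parallel (v x f) (v y f)" if "Q' f"
          using that x yg unfolding Q'_def by blast
        ultimately show "\<not> (P x \<and> P' f)" "\<not> (Q x \<and> Q' f)"
          using parallel_trans by blast+
      qed
      show ?thesis using cross PQ PQ' x0 f0 by blast
    qed
  qed
  then show ?thesis
  proof
    assume *: "(\<forall>x\<in>X-{0}. P x) \<and> (\<forall>f\<in>Y-{0}. Q' f)"
    show ?thesis
      unfolding clinear_on_def conj_assoc
      by (rule disjI1, rule factorization[OF ne]) (use * in \<open>auto simp: P_def Q'_def\<close>)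
  next
    assume *: "(\<forall>x\<in>X-{0}. Q x) \<and> (\<forall>f\<in>Y-{0}. P' f)"
    have "\<exists>V U. conj_linear_on X V \<and> conj_linear_on Y U \<and>
        (\<forall>x\<in>X. \<forall>f\<in>Y. rank_one (v x f) (u x f) = rank_one (V x) (U f))"
      unfolding conj_linear_on_def conj_assoc
      by (rule adj.factorization[OF ne]) (use * in \<open>auto simp: Q_def P'_def\<close>)
    then obtain V U where VU: "conj_linear_on X V" "conj_linear_on Y U"
      "\<forall>x\<in>X. \<forall>f\<in>Y. rank_one (v x f) (u x f) = rank_one (V x) (U f)"
      by (elim exE conjE)
    have "rank_one (u x f) (v x f) = rank_one (U f) (V x)" if "x \<in> X" "f \<in> Y" for x f
      by (rule rank_one_adjoint) (use VU(3) that in blast)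
    then show ?thesis using VU(1,2) by (intro disjI2 exI[of _ U] exI[of _ V] conjI ballI)
  qed
qed


section \<open>Rank preserving maps on rank one operators\<close>

text \<open>The constant is not optimal, but the bound comes directly from the real inner product, and only
  boundedness of operators of rank one depends on it.\<close>

lemma cmod_cinner_le: "cmod (cinner x y) \<le> 2 * (norm x * norm y)"
proof -
  have "cmod (cinner x y) \<le> \<bar>inner x y\<bar> + \<bar>inner x (\<i> *\<^sub>C y)\<bar>"
    using cmod_le[of "cinner x y"] by (simp add: cinner_eq_Complex)
  also have "\<dots> \<le> norm x * norm y + norm x * norm (\<i> *\<^sub>C y)"
    by (intro add_mono Cauchy_Schwarz_ineq2)
  finally show ?thesis by (simp add: norm_scaleC)
qed

lemma rank_one_in_bounded_ops: "rank_one x f \<in> bounded_ops UNIV"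
proof -
  have "norm (rank_one x f h) \<le> (2 * norm f * norm x) * norm h" for h
    using mult_right_mono[OF cmod_cinner_le[of h f], of "norm x"]
    by (simp add: rank_one_apply norm_scaleC mult_ac)
  then show ?thesis
    by (auto simp: bounded_ops_def clinear_on_def PiE_UNIV_domain rank_one_apply cinner_add_left
        cinner_scaleC_left scaleC_add_left scaleC_scaleC)
qed

lemma rank_one_in_Alg:
  assumes L: "subspace_lattice \<LL>" and "N \<in> \<LL>" "x \<in> N" "f \<in> perp (lower \<LL> N)"
  shows "rank_one x f \<in> Alg \<LL>"
proof -
  have "rank_one x f h \<in> E" if E: "E \<in> \<LL>" "h \<in> E" for E h
  proof (cases "N \<subseteq> E")
    case True
    then show ?thesis
      using assms(3) complex_vector.subspace_scale[OF subspace_latticeD(1)[OF L E(1)]]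
      by (auto simp: rank_one_apply)
  next
    case False
    then have "h \<in> lower \<LL> N"
      using E join_upper[of E "{K \<in> \<LL>. \<not> N \<subseteq> K}"] unfolding lower_def by blast
    then have "cinner h f = 0" using assms(4) cinner_eq_0_commute by (auto simp: perp_def)
    then show ?thesis
      using complex_vector.subspace_0[OF subspace_latticeD(1)[OF L E(1)]]
      by (simp add: rank_one_apply)
  qed
  then show ?thesis by (auto simp: Alg_on_def rank_one_in_bounded_ops)
qed

lemma lower_mono: "K \<subseteq> N \<Longrightarrow> lower \<LL> K \<subseteq> lower \<LL> N"
  unfolding lower_def by (rule join_mono) blast

lemma perp_antimono: "S \<subseteq> T \<Longrightarrow> perp T \<subseteq> perp S"
  by (auto simp: perp_def)

lemma perp_lower_nonzero:
  assumes "lower \<LL> N \<noteq> UNIV"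
  shows "perp (lower \<LL> N) \<noteq> {0}"
  using assms perp_eq_0_iff closed_csubspace_join unfolding lower_def by blast

lemma csubspace_nonzero_vector:
  assumes "csubspace S" "S \<noteq> {0}"
  obtains x where "x \<in> S - {0}"
  using assms complex_vector.subspace_0 by blast

context
  fixes \<LL> :: "'a::chilbert_space set set" and \<Phi> :: "('a \<Rightarrow> 'a) \<Rightarrow> ('a \<Rightarrow> 'a)"
  assumes L: "subspace_lattice \<LL>" and \<Phi>: "rank_preserving_map \<LL> \<Phi>"
begin

lemma \<Phi>_add: "A \<in> Alg \<LL> \<Longrightarrow> B \<in> Alg \<LL> \<Longrightarrow> \<Phi> (\<lambda>h. A h + B h) = (\<lambda>h. \<Phi> A h + \<Phi> B h)"
  and \<Phi>_scaleC: "A \<in> Alg \<LL> \<Longrightarrow> \<Phi> (\<lambda>h. c *\<^sub>C A h) = (\<lambda>h. c *\<^sub>C \<Phi> A h)"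
  using \<Phi> unfolding rank_preserving_map_def by blast+

lemma Alg_add:
  assumes A: "A \<in> Alg \<LL>" and B: "B \<in> Alg \<LL>"
  shows "(\<lambda>h. A h + B h) \<in> Alg \<LL>"
proof -
  obtain a b where "\<And>x. norm (A x) \<le> a * norm x" "\<And>x. norm (B x) \<le> b * norm x"
    using A B by (auto simp: Alg_on_def bounded_ops_def)
  then have "norm (A x + B x) \<le> (a + b) * norm x" for x
    unfolding distrib_right by (rule norm_triangle_mono)
  then have "(\<lambda>h. A h + B h) \<in> bounded_ops UNIV"
    using A B by (auto simp: Alg_on_def bounded_ops_def clinear_on_def PiE_UNIV_domain
        scaleC_add_right algebra_simps intro!: exI[of _ "a + b"])
  moreover have "A h + B h \<in> E" if "E \<in> \<LL>" "h \<in> E" for E h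
  proof (rule complex_vector.subspace_add[OF subspace_latticeD(1)[OF L \<open>E \<in> \<LL>\<close>]])
    show "A h \<in> E" "B h \<in> E" using A B that unfolding Alg_on_def by blast+
  qed
  ultimately show ?thesis by (auto simp: Alg_on_def)
qed

lemma \<Phi>_rank_one:
  assumes "rank_one x f \<in> Alg \<LL>" "x \<noteq> 0" "f \<noteq> 0"
  shows "\<exists>u v. u \<noteq> 0 \<and> v \<noteq> 0 \<and> \<Phi> (rank_one x f) = rank_one u v"
proof (rule bounded_op_rank_one)
  show "\<Phi> (rank_one x f) \<in> bounded_ops UNIV"
    using \<Phi> assms(1) by (auto simp: rank_preserving_map_def Alg_on_def Pi_def)
  show "rank_op (\<Phi> (rank_one x f)) = 1"
    using \<Phi> assms(1) finite_rank_rank_one[of x f] rank_op_rank_one[OF assms(2,3)]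
    unfolding rank_preserving_map_def by metis
qed

lemma \<Phi>_rank_one_nonzero:
  assumes "rank_one x f \<in> Alg \<LL>" "x \<noteq> 0" "f \<noteq> 0" "\<Phi> (rank_one x f) = rank_one u v"
  shows "u \<noteq> 0 \<and> v \<noteq> 0"
proof -
  obtain a b where ab: "a \<noteq> 0" "b \<noteq> 0" "rank_one u v = rank_one a b"
    using \<Phi>_rank_one[OF assms(1-3)] assms(4) by metis
  then have "rank_one u v b \<noteq> 0" by (simp add: rank_one_apply)
  then show ?thesis by auto
qed

lemma \<Phi>_rank_two:
  assumes A: "rank_one x f \<in> Alg \<LL>" "rank_one y g \<in> Alg \<LL>"
    and x: "x \<noteq> 0" "y \<noteq> 0" "\<not> parallel x y" and f: "f \<noteq> 0" "g \<noteq> 0" "\<not> parallel f g"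
  shows "(\<lambda>h. \<Phi> (rank_one x f) h + \<Phi> (rank_one y g) h) \<noteq> rank_one w z"
proof
  assume "(\<lambda>h. \<Phi> (rank_one x f) h + \<Phi> (rank_one y g) h) = rank_one w z"
  then have "rank_one w z = \<Phi> (\<lambda>h. rank_one x f h + rank_one y g h)"
    using \<Phi>_add[OF A] by simp
  moreover have "rank_op \<dots> = rank_op (\<lambda>h. rank_one x f h + rank_one y g h)"
    using \<Phi> Alg_add[OF A] finite_rank_rank_one_sum unfolding rank_preserving_map_def by blast
  ultimately show False
    using rank_op_rank_one_sum[OF x f] rank_op_rank_one_le[of w z] by simp
qed

text \<open>Choosing the two factors of each \<open>\<Phi>(x \<otimes> f\<^sup>*)\<close> makes \<open>\<Phi>\<close>, restricted to \<open>N \<times> N\<^sub>-\<^sup>\<bottom>\<close>, a family to which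
  the dichotomy for sesquilinear families of rank one operators applies.\<close>

lemma consistent_or_twisted:
  assumes N: "N \<in> \<LL>" "N \<noteq> {0}" "lower \<LL> N \<noteq> UNIV"
  shows "consistent \<LL> \<Phi> N \<or> twisted \<LL> \<Phi> N"
proof -
  let ?Y = "perp (lower \<LL> N)"
  note subN = subspace_latticeD(1)[OF L N(1)]
  have subY: "csubspace ?Y" by (rule closed_csubspace_perp)
  have alg: "rank_one x f \<in> Alg \<LL>" if "x \<in> N" "f \<in> ?Y" for x f
    using rank_one_in_Alg[OF L N(1) that] .
  have zero: "\<Phi> (\<lambda>h. 0) = (\<lambda>h. 0)"
    using \<Phi>_scaleC[OF alg[of 0 0], of 0] complex_vector.subspace_0[OF subN]
      complex_vector.subspace_0[OF subY] by simp
  have "\<exists>u v. \<Phi> (rank_one x f) = rank_one u v \<and> (x \<noteq> 0 \<longrightarrow> f \<noteq> 0 \<longrightarrow> u \<noteq> 0 \<and> v \<noteq> 0)"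
    if "x \<in> N" "f \<in> ?Y" for x f
  proof (cases "x = 0 \<or> f = 0")
    case True
    then have "\<Phi> (rank_one x f) = rank_one 0 0" using zero by auto
    then show ?thesis using True by blast
  next
    case False
    then show ?thesis using \<Phi>_rank_one[OF alg[OF that]] by blast
  qed
  then obtain u v where uv: "\<And>x f. x \<in> N \<Longrightarrow> f \<in> ?Y \<Longrightarrow> \<Phi> (rank_one x f) = rank_one (u x f) (v x f)"
    and nz: "\<And>x f. x \<in> N \<Longrightarrow> f \<in> ?Y \<Longrightarrow> x \<noteq> 0 \<Longrightarrow> f \<noteq> 0 \<Longrightarrow> u x f \<noteq> 0 \<and> v x f \<noteq> 0"
    by metis
  have fam: "rank_one_family N ?Y (\<lambda>c. c) u v"
  proof
    show "csubspace N" "csubspace ?Y" by (rule subN subY)+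
    show "surj (\<lambda>c::complex. c)" by (simp add: surj_def)
    show "rank_one (u (x + y) f) (v (x + y) f) =
        (\<lambda>h. rank_one (u x f) (v x f) h + rank_one (u y f) (v y f) h)"
      if "x \<in> N" "y \<in> N" "f \<in> ?Y" for x y f
      using uv[of "x + y" f] complex_vector.subspace_add[OF subN] \<Phi>_add[OF alg alg, of x f y f]
        uv that by (simp add: rank_one_add_left)
    show "rank_one (u x (f + g)) (v x (f + g)) =
        (\<lambda>h. rank_one (u x f) (v x f) h + rank_one (u x g) (v x g) h)"
      if "x \<in> N" "f \<in> ?Y" "g \<in> ?Y" for x f g
      using uv[of x "f + g"] complex_vector.subspace_add[OF subY]
        \<Phi>_add[OF alg alg, of x f x g] uv that by (simp add: rank_one_add_right)
    show "rank_one (u (c *\<^sub>C x) f) (v (c *\<^sub>C x) f) = (\<lambda>h. c *\<^sub>C rank_one (u x f) (v x f) h)"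
      if "x \<in> N" "f \<in> ?Y" for x f c
      using uv[of "c *\<^sub>C x" f] complex_vector.subspace_scale[OF subN]
        \<Phi>_scaleC[OF alg, of x f c] uv that by (simp add: rank_one_scaleC_left)
    show "rank_one (u x (c *\<^sub>C f)) (v x (c *\<^sub>C f)) = (\<lambda>h. cnj c *\<^sub>C rank_one (u x f) (v x f) h)"
      if "x \<in> N" "f \<in> ?Y" for x f c
      using uv[of x "c *\<^sub>C f"] complex_vector.subspace_scale[OF subY]
        \<Phi>_scaleC[OF alg, of x f "cnj c"] uv that by (simp add: rank_one_scaleC_right)
    show "x \<in> N \<Longrightarrow> x \<noteq> 0 \<Longrightarrow> f \<in> ?Y \<Longrightarrow> f \<noteq> 0 \<Longrightarrow> u x f \<noteq> 0 \<and> v x f \<noteq> 0" for x f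
      using nz by blast
  qed
  have rank2: "(\<lambda>h. rank_one (u x f) (v x f) h + rank_one (u y g) (v y g) h) \<noteq> rank_one w z"
    if x: "x \<in> N - {0}" "y \<in> N - {0}" "\<not> parallel x y"
      and f: "f \<in> ?Y - {0}" "g \<in> ?Y - {0}" "\<not> parallel f g" for x y f g w z
  proof -
    have "rank_one x f \<in> Alg \<LL>" "rank_one y g \<in> Alg \<LL>" using alg x f by blast+
    from \<Phi>_rank_two[OF this _ _ x(3) _ _ f(3), of w z] show ?thesis using uv x f by simp
  qed
  from rank_one_family_dichotomy[OF fam N(2) perp_lower_nonzero[OF N(3)] rank2] show ?thesis
    unfolding consistent_def twisted_def using N uv by (simp cong: ball_cong)
qed

text \<open>Call the operators \<open>x \<otimes> f\<^sup>*\<close> with \<open>x \<in> N\<close> and \<open>f \<in> N\<^sub>-\<^sup>\<bottom>\<close> the block of \<open>N\<close>. If \<open>K \<le> N\<close>, then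
  the operators \<open>k \<otimes> g\<^sup>*\<close> with \<open>k \<in> K\<close> and \<open>g \<in> N\<^sub>-\<^sup>\<bottom>\<close> are common to both blocks. If neither block is
  contained in the other, then there are operators \<open>k \<otimes> f\<^sup>*\<close> and \<open>x \<otimes> g\<^sup>*\<close> of the two blocks whose sum has rank two,
  where \<open>k \<in> K\<close> and \<open>g \<in> N\<^sub>-\<^sup>\<bottom>\<close> may be prescribed.\<close>

lemma blocks_comparable:
  assumes NK: "N \<in> \<LL>" "K \<in> \<LL>" "K \<subseteq> N" "K \<noteq> {0}" "lower \<LL> N \<noteq> UNIV"
    and degenerate: "\<And>k f x g. k \<in> K - {0} \<Longrightarrow> f \<in> perp (lower \<LL> K) - {0} \<Longrightarrow> x \<in> N - {0} \<Longrightarrow>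
      g \<in> perp (lower \<LL> N) - {0} \<Longrightarrow>
      \<exists>w z. (\<lambda>h. \<Phi> (rank_one k f) h + \<Phi> (rank_one x g) h) = rank_one w z"
  shows "K = N \<or> perp (lower \<LL> K) = perp (lower \<LL> N)"
proof -
  obtain k where k: "k \<in> K - {0}"
    using csubspace_nonzero_vector[OF subspace_latticeD(1)[OF L NK(2)] NK(4)] .
  obtain g where g: "g \<in> perp (lower \<LL> N) - {0}"
    using csubspace_nonzero_vector[OF closed_csubspace_perp(1) perp_lower_nonzero[OF NK(5)]] .
  have "parallel k x \<or> parallel f g"
    if x: "x \<in> N - {0}" and f: "f \<in> perp (lower \<LL> K) - {0}" for x f
    using degenerate[OF k f x g] \<Phi>_rank_two[of k f x g] rank_one_in_Alg[OF L NK(2), of k f]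
      rank_one_in_Alg[OF L NK(1), of x g] k f x g by blast
  then consider "\<forall>x\<in>N-{0}. parallel k x" | "\<forall>f\<in>perp (lower \<LL> K) - {0}. parallel f g" by blast
  then show ?thesis
  proof cases
    case 1
    have "x \<in> K" if "x \<in> N" for x
    proof (cases "x = 0")
      case True
      then show ?thesis using complex_vector.subspace_0 subspace_latticeD(1)[OF L NK(2)] by blast
    next
      case False
      then obtain c where "x = c *\<^sub>C k" using 1 \<open>x \<in> N\<close> by (auto simp: parallel_def)
      then show ?thesis
        using k complex_vector.subspace_scale[OF subspace_latticeD(1)[OF L NK(2)]] by simp
    qed
    then show ?thesis using NK(3) by blast
  next
    case 2
    have "f \<in> perp (lower \<LL> N)" if "f \<in> perp (lower \<LL> K)" for f
    proof (cases "f = 0")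
      case True
      then show ?thesis using complex_vector.subspace_0 closed_csubspace_perp by blast
    next
      case False
      then obtain c where "f = c *\<^sub>C g"
        using 2 \<open>f \<in> perp (lower \<LL> K)\<close> parallel_sym unfolding parallel_def by blast
      then show ?thesis
        using g complex_vector.subspace_scale[OF closed_csubspace_perp(1)] by blast
    qed
    moreover have "perp (lower \<LL> N) \<subseteq> perp (lower \<LL> K)"
      by (intro perp_antimono lower_mono NK)
    ultimately show ?thesis by blast
  qed
qed

text \<open>If \<open>K\<close> is twisted, then \<open>\<Phi>(k \<otimes> g\<^sup>*)\<close> has both forms for \<open>k \<in> K\<close> and \<open>g \<in> N\<^sub>-\<^sup>\<bottom>\<close>. So the images of
  \<open>k \<otimes> f\<^sup>*\<close> and \<open>x \<otimes> g\<^sup>*\<close> have the same second factor up to a scalar, for all \<open>f\<close> and \<open>x\<close>, and their sum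
  has rank at most one. By the preceding lemma the block of \<open>K\<close> differs from that of \<open>N\<close> in at most
  one of its two sides, and the consistent form restricts to \<open>K\<close>.\<close>

lemma consistent_hereditary:
  assumes N: "consistent \<LL> \<Phi> N" and K: "K \<in> \<LL>" "K \<subseteq> N" "K \<noteq> {0}"
  shows "consistent \<LL> \<Phi> K"
proof -
  obtain U V where N': "N \<in> \<LL>" "lower \<LL> N \<noteq> UNIV"
    and UV: "clinear_on N U" "clinear_on (perp (lower \<LL> N)) V"
      "\<And>x f. x \<in> N \<Longrightarrow> f \<in> perp (lower \<LL> N) \<Longrightarrow> \<Phi> (rank_one x f) = rank_one (U x) (V f)"
    using N unfolding consistent_def by blast
  have sub: "perp (lower \<LL> N) \<subseteq> perp (lower \<LL> K)"
    by (intro perp_antimono lower_mono K)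
  have lK: "lower \<LL> K \<noteq> UNIV" using lower_mono[OF K(2), of \<LL>] N'(2) by blast
  from consistent_or_twisted[OF K(1,3) lK] show ?thesis
  proof
    assume "twisted \<LL> \<Phi> K"
    then obtain U' V' where T:
      "\<And>x f. x \<in> K \<Longrightarrow> f \<in> perp (lower \<LL> K) \<Longrightarrow> \<Phi> (rank_one x f) = rank_one (U' f) (V' x)"
      unfolding twisted_def by blast
    have "K = N \<or> perp (lower \<LL> K) = perp (lower \<LL> N)"
    proof (rule blocks_comparable[OF N'(1) K N'(2)])
      fix k f x g
      assume a: "k \<in> K - {0}" "f \<in> perp (lower \<LL> K) - {0}" "x \<in> N - {0}"
        "g \<in> perp (lower \<LL> N) - {0}"
      have kg: "\<Phi> (rank_one k g) = rank_one (U' g) (V' k)" using T[of k g] a sub by blast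
      have "\<Phi> (rank_one k g) = rank_one (U k) (V g)" using UV(3)[of k g] a K by blast
      with kg have eq: "rank_one (U' g) (V' k) = rank_one (U k) (V g)" by metis
      have "rank_one k g \<in> Alg \<LL>" using rank_one_in_Alg[OF L N'(1), of k g] a K by blast
      from \<Phi>_rank_one_nonzero[OF this _ _ kg] have "U' g \<noteq> 0" "V' k \<noteq> 0" using a by auto
      from rank_one_eq_parallel(2)[OF eq this] have "parallel (V' k) (V g)" .
      then show "\<exists>w z. (\<lambda>h. \<Phi> (rank_one k f) h + \<Phi> (rank_one x g) h) = rank_one w z"
        using parallel_rank_one_sum[of "U' f" "U x" "V' k" "V g"] T[of k f] UV(3)[of x g] a by simp
    qed
    then show ?thesis
    proof
      assume eq: "perp (lower \<LL> K) = perp (lower \<LL> N)"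
      have "clinear_on K U" using UV(1) K(2) unfolding clinear_on_def by blast
      moreover have "\<forall>x\<in>K. \<forall>f\<in>perp (lower \<LL> N). \<Phi> (rank_one x f) = rank_one (U x) (V f)"
        using UV(3) K(2) by blast
      ultimately show ?thesis
        unfolding consistent_def eq using K(1,3) lK UV(2) by blast
    qed (use N in simp)
  qed
qed

text \<open>The same argument with the first factors in place of the second ones.\<close>

lemma twisted_hereditary:
  assumes N: "twisted \<LL> \<Phi> N" and K: "K \<in> \<LL>" "K \<subseteq> N" "K \<noteq> {0}"
  shows "twisted \<LL> \<Phi> K"
proof -
  obtain U V where N': "N \<in> \<LL>" "lower \<LL> N \<noteq> UNIV"
    and UV: "conj_linear_on (perp (lower \<LL> N)) U" "conj_linear_on N V"
      "\<And>x f. x \<in> N \<Longrightarrow> f \<in> perp (lower \<LL> N) \<Longrightarrow> \<Phi> (rank_one x f) = rank_one (U f) (V x)"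
    using N unfolding twisted_def by blast
  have sub: "perp (lower \<LL> N) \<subseteq> perp (lower \<LL> K)"
    by (intro perp_antimono lower_mono K)
  have lK: "lower \<LL> K \<noteq> UNIV" using lower_mono[OF K(2), of \<LL>] N'(2) by blast
  from consistent_or_twisted[OF K(1,3) lK] show ?thesis
  proof
    assume "consistent \<LL> \<Phi> K"
    then obtain U' V' where T:
      "\<And>x f. x \<in> K \<Longrightarrow> f \<in> perp (lower \<LL> K) \<Longrightarrow> \<Phi> (rank_one x f) = rank_one (U' x) (V' f)"
      unfolding consistent_def by blast
    have "K = N \<or> perp (lower \<LL> K) = perp (lower \<LL> N)"
    proof (rule blocks_comparable[OF N'(1) K N'(2)])
      fix k f x g
      assume a: "k \<in> K - {0}" "f \<in> perp (lower \<LL> K) - {0}" "x \<in> N - {0}"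
        "g \<in> perp (lower \<LL> N) - {0}"
      have kg: "\<Phi> (rank_one k g) = rank_one (U' k) (V' g)" using T[of k g] a sub by blast
      have "\<Phi> (rank_one k g) = rank_one (U g) (V k)" using UV(3)[of k g] a K by blast
      with kg have eq: "rank_one (U' k) (V' g) = rank_one (U g) (V k)" by metis
      have "rank_one k g \<in> Alg \<LL>" using rank_one_in_Alg[OF L N'(1), of k g] a K by blast
      from \<Phi>_rank_one_nonzero[OF this _ _ kg] have "U' k \<noteq> 0" "V' g \<noteq> 0" using a by auto
      from rank_one_eq_parallel(1)[OF eq this] have "parallel (U' k) (U g)" .
      then show "\<exists>w z. (\<lambda>h. \<Phi> (rank_one k f) h + \<Phi> (rank_one x g) h) = rank_one w z"
        using parallel_rank_one_sum[of "U' k" "U g" "V' f" "V x"] T[of k f] UV(3)[of x g] a by simp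
    qed
    then show ?thesis
    proof
      assume eq: "perp (lower \<LL> K) = perp (lower \<LL> N)"
      have "conj_linear_on K V" using UV(2) K(2) unfolding conj_linear_on_def by blast
      moreover have "\<forall>x\<in>K. \<forall>f\<in>perp (lower \<LL> N). \<Phi> (rank_one x f) = rank_one (U f) (V x)"
        using UV(3) K(2) by blast
      ultimately show ?thesis
        unfolding twisted_def eq using K(1,3) lK UV(1) by blast
    qed (use N in simp)
  qed
qed

text \<open>From \<open>U(x) \<otimes> V(f)\<^sup>* = U'(f) \<otimes> V'(x)\<^sup>*\<close> it follows that all \<open>U(x)\<close> are parallel and all \<open>V(f)\<close> are
  parallel. But \<open>U\<close> and \<open>V\<close> are injective, because \<open>\<Phi>\<close> sends no operator of rank one to zero.\<close>

lemma consistent_twisted_one_dimensional: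
  assumes c: "consistent \<LL> \<Phi> N" and t: "twisted \<LL> \<Phi> N"
  shows "\<And>x y. x \<in> N - {0} \<Longrightarrow> y \<in> N - {0} \<Longrightarrow> parallel x y"
    and "\<And>f g. f \<in> perp (lower \<LL> N) - {0} \<Longrightarrow> g \<in> perp (lower \<LL> N) - {0} \<Longrightarrow> parallel f g"
proof -
  let ?Y = "perp (lower \<LL> N)"
  obtain U V where N: "N \<in> \<LL>" "N \<noteq> {0}" "lower \<LL> N \<noteq> UNIV"
    and UV: "clinear_on N U" "clinear_on ?Y V"
      "\<And>x f. x \<in> N \<Longrightarrow> f \<in> ?Y \<Longrightarrow> \<Phi> (rank_one x f) = rank_one (U x) (V f)"
    using c unfolding consistent_def by blast
  obtain U' V' where
    UV': "\<And>x f. x \<in> N \<Longrightarrow> f \<in> ?Y \<Longrightarrow> \<Phi> (rank_one x f) = rank_one (U' f) (V' x)"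
    using t unfolding twisted_def by blast
  note subN = subspace_latticeD(1)[OF L N(1)] and subY = closed_csubspace_perp(1)
  have nz: "U x \<noteq> 0 \<and> V f \<noteq> 0" if "x \<in> N - {0}" "f \<in> ?Y - {0}" for x f
    using \<Phi>_rank_one_nonzero[of x f] UV(3)[of x f] rank_one_in_Alg[OF L N(1), of x f] that by blast
  have par: "parallel (U x) (U' f)" "parallel (V f) (V' x)" if "x \<in> N - {0}" "f \<in> ?Y - {0}" for x f
  proof -
    have "rank_one (U x) (V f) = rank_one (U' f) (V' x)"
      using UV(3)[of x f] UV'[of x f] that by auto
    then show "parallel (U x) (U' f)" "parallel (V f) (V' x)"
      using rank_one_eq_parallel nz[OF that] by blast+
  qed
  obtain x0 where x0: "x0 \<in> N - {0}" using csubspace_nonzero_vector[OF subN N(2)] .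
  obtain f0 where f0: "f0 \<in> ?Y - {0}"
    using csubspace_nonzero_vector[OF subY perp_lower_nonzero[OF N(3)]] .
  show "parallel x y" if x: "x \<in> N - {0}" and y: "y \<in> N - {0}" for x y
  proof -
    have "parallel (U x) (U y)"
      using par(1)[OF x f0] par(1)[OF y f0] parallel_trans parallel_sym by blast
    then obtain c where c: "U y = c *\<^sub>C U x" by (auto simp: parallel_def)
    have cx: "(- c) *\<^sub>C x \<in> N" using x complex_vector.subspace_scale[OF subN] by blast
    have "U (y + (- c) *\<^sub>C x) = U y + U ((- c) *\<^sub>C x)"
      using UV(1) x y cx unfolding clinear_on_def by blast
    also have "U ((- c) *\<^sub>C x) = (- c) *\<^sub>C U x"
      using UV(1) x unfolding clinear_on_def by blast
    finally have "U (y + (- c) *\<^sub>C x) = 0" using c by simp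
    moreover have "y + (- c) *\<^sub>C x \<in> N" using y cx complex_vector.subspace_add[OF subN] by blast
    ultimately have "y + (- c) *\<^sub>C x = 0" using nz[OF _ f0] by blast
    then have "y = c *\<^sub>C x" by simp
    then show ?thesis using y parallel_scaleC by auto
  qed
  show "parallel f g" if f: "f \<in> ?Y - {0}" and g: "g \<in> ?Y - {0}" for f g
  proof -
    have "parallel (V f) (V g)"
      using par(2)[OF x0 f] par(2)[OF x0 g] parallel_trans parallel_sym by blast
    then obtain c where c: "V g = c *\<^sub>C V f" by (auto simp: parallel_def)
    have cf: "(- c) *\<^sub>C f \<in> ?Y" using f complex_vector.subspace_scale[OF subY] by blast
    have "V (g + (- c) *\<^sub>C f) = V g + V ((- c) *\<^sub>C f)"
      using UV(2) f g cf unfolding clinear_on_def by blast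
    also have "V ((- c) *\<^sub>C f) = (- c) *\<^sub>C V f"
      using UV(2) f unfolding clinear_on_def by blast
    finally have "V (g + (- c) *\<^sub>C f) = 0" using c by simp
    moreover have "g + (- c) *\<^sub>C f \<in> ?Y" using g cf complex_vector.subspace_add[OF subY] by blast
    ultimately have "g + (- c) *\<^sub>C f = 0" using nz[OF x0] by blast
    then have "g = c *\<^sub>C f" by simp
    then show ?thesis using g parallel_scaleC by auto
  qed
qed

end


section \<open>Isolated elements\<close>

text \<open>An element \<open>K\<close> of a commutative lattice that does not contain the line \<open>N\<close> is orthogonal to it.
  So the elements that do not contain \<open>N\<close> are closed under joins and their join \<open>N\<^sub>-\<close> is in the lattice
  and orthogonal to \<open>N\<close>; as its complement is a line too, it is \<open>N\<^sup>\<bottom>\<close>.\<close>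

lemma isolatedI:
  assumes L: "subspace_lattice \<LL>" and comm: "commutative_lattice \<LL>"
    and N: "N \<in> \<LL>" "N \<noteq> {0}" "lower \<LL> N \<noteq> UNIV"
    and dimN: "\<And>x y. x \<in> N - {0} \<Longrightarrow> y \<in> N - {0} \<Longrightarrow> parallel x y"
    and dimY: "\<And>f g. f \<in> perp (lower \<LL> N) - {0} \<Longrightarrow> g \<in> perp (lower \<LL> N) - {0} \<Longrightarrow> parallel f g"
  shows "isolated \<LL> N"
proof -
  note subN = subspace_latticeD[OF L N(1)]
  obtain e where e: "e \<in> N - {0}" using csubspace_nonzero_vector[OF subN(1) N(2)] .
  have Ne: "\<exists>c. x = c *\<^sub>C e" if "x \<in> N" for x
    using dimN[OF e, of x] that unfolding parallel_def
    by (cases "x = 0") (auto intro: exI[of _ 0])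
  have orth: "K \<subseteq> perp N" if K: "K \<in> \<LL>" "\<not> N \<subseteq> K" for K
  proof -
    note subK = subspace_latticeD[OF L K(1)]
    have "e \<notin> K"
    proof
      assume "e \<in> K"
      then have "N \<subseteq> K" using Ne complex_vector.subspace_scale[OF subK(1)] by blast
      then show False using K(2) by blast
    qed
    have "proj K e \<in> N" using commutative_lattice_proj_image[OF L comm K(1) N(1)] e by blast
    moreover have "proj K e \<in> K" using proj_in[OF subK] .
    ultimately have "proj K e = 0"
    proof (rule_tac ccontr)
      assume "proj K e \<in> N" "proj K e \<in> K" "proj K e \<noteq> 0"
      then obtain c where "e = c *\<^sub>C proj K e" using dimN[of "proj K e" e] e
        by (auto simp: parallel_def)
      then show False
        using \<open>e \<notin> K\<close> \<open>proj K e \<in> K\<close> complex_vector.subspace_scale[OF subK(1)] by metis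
    qed
    then have "e \<in> perp K" using diff_proj_in_perp[OF subK, of e] by simp
    then have "N \<subseteq> perp K"
      using Ne complex_vector.subspace_scale[OF closed_csubspace_perp(1)] by blast
    then show ?thesis by (simp add: subset_perp_commute)
  qed
  have lower_perp: "lower \<LL> N \<subseteq> perp N"
    unfolding lower_def by (rule join_least[OF closed_csubspace_perp]) (use orth in blast)
  have "lower \<LL> N \<in> \<LL>"
    unfolding lower_def
  proof (rule directed_join_in_lattice[OF L])
    have "{0} \<in> \<LL>" "\<not> N \<subseteq> {0}" using L e by (auto simp: subspace_lattice_def)
    then show "{K \<in> \<LL>. \<not> N \<subseteq> K} \<noteq> {}" by blast
    fix F G assume FG: "F \<in> {K \<in> \<LL>. \<not> N \<subseteq> K}" "G \<in> {K \<in> \<LL>. \<not> N \<subseteq> K}"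
    have "join {F, G} \<subseteq> perp N"
      by (rule join_least[OF closed_csubspace_perp]) (use FG orth in blast)
    then have "\<not> N \<subseteq> join {F, G}" using e in_perp_both_eq_0 by blast
    moreover have "join {F, G} \<in> \<LL>" using L FG by (simp add: subspace_lattice_def)
    ultimately show "\<exists>H\<in>{K \<in> \<LL>. \<not> N \<subseteq> K}. F \<subseteq> H \<and> G \<subseteq> H"
      using join_upper[of F "{F, G}"] join_upper[of G "{F, G}"] by blast
  qed blast
  moreover have "perp N = lower \<LL> N"
  proof
    have "N \<subseteq> perp (lower \<LL> N)" using lower_perp by (simp add: subset_perp_commute)
    then have eY: "e \<in> perp (lower \<LL> N) - {0}" using e by blast
    have "f \<in> N" if f: "f \<in> perp (lower \<LL> N)" for f
    proof (cases "f = 0")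
      case False
      then obtain c where "f = c *\<^sub>C e" using dimY[OF eY, of f] f by (auto simp: parallel_def)
      then show ?thesis using e complex_vector.subspace_scale[OF subN(1)] by blast
    qed (use complex_vector.subspace_0[OF subN(1)] in simp)
    then have "perp N \<subseteq> perp (perp (lower \<LL> N))" by (intro perp_antimono) blast
    also have "\<dots> = lower \<LL> N"
      unfolding lower_def by (rule perp_perp[OF closed_csubspace_join])
    finally show "perp N \<subseteq> lower \<LL> N" .
  qed (rule lower_perp)
  moreover have "cdim N = 1"
  proof (rule complex_vector.dim_unique[of "{e}"])
    show "N \<subseteq> cspan {e}" using Ne by (auto simp: complex_vector.span_singleton)
  qed (use e in auto)
  ultimately show ?thesis using N(1) by (simp add: isolated_def)
qed

text \<open>Below a consistent and a twisted element, all elements carrying rank one operators inherit both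
  properties.\<close>

lemma consistent_meet_twisted:
  assumes L: "subspace_lattice \<LL>" and comm: "commutative_lattice \<LL>"
    and cd: "completely_distributive \<LL>" and \<Phi>: "rank_preserving_map \<LL> \<Phi>"
    and N: "consistent \<LL> \<Phi> N" and M: "twisted \<LL> \<Phi> M"
  shows "N \<inter> M \<subseteq> M_i \<LL>"
proof (rule lattice_element_subsetI[OF L cd])
  have "N \<in> \<LL>" "M \<in> \<LL>" using N M by (auto simp: consistent_def twisted_def)
  then show "N \<inter> M \<in> \<LL>" using L by (simp add: subspace_lattice_def)
  show "csubspace (M_i \<LL>)" "closed (M_i \<LL>)"
    unfolding M_i_def by (rule closed_csubspace_join)+
  fix K assume K: "K \<in> \<LL>" "K \<subseteq> N \<inter> M" "K \<noteq> {0}" "lower \<LL> K \<noteq> UNIV"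
  have "consistent \<LL> \<Phi> K" "twisted \<LL> \<Phi> K"
    using consistent_hereditary[OF L \<Phi> N K(1)] twisted_hereditary[OF L \<Phi> M K(1)] K by auto
  from isolatedI[OF L comm K(1,3,4) consistent_twisted_one_dimensional[OF L \<Phi> this]]
  have "isolated \<LL> K" .
  then show "K \<subseteq> M_i \<LL>" unfolding M_i_def by (simp add: join_upper)
qed


section \<open>Decomposition of the algebra\<close>

lemma range_compression:
  assumes M: "csubspace M" "closed M" and E: "csubspace E" "closed E" and inv: "proj E ` M \<subseteq> M"
  shows "range (proj M \<circ> proj E \<circ> proj M) = E \<inter> M"
proof
  show "range (proj M \<circ> proj E \<circ> proj M) \<subseteq> E \<inter> M"
  proof
    fix y assume "y \<in> range (proj M \<circ> proj E \<circ> proj M)"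
    then obtain x where x: "y = proj M (proj E (proj M x))" by auto
    have "proj E (proj M x) \<in> M" using inv proj_in[OF M] by blast
    then have "y = proj E (proj M x)" using x proj_id[OF M(1)] by simp
    then show "y \<in> E \<inter> M" using \<open>proj E (proj M x) \<in> M\<close> proj_in[OF E] by simp
  qed
  show "E \<inter> M \<subseteq> range (proj M \<circ> proj E \<circ> proj M)"
  proof
    fix y assume "y \<in> E \<inter> M"
    then have "y = (proj M \<circ> proj E \<circ> proj M) y"
      using proj_id[OF M(1)] proj_id[OF E(1)] by simp
    then show "y \<in> range (proj M \<circ> proj E \<circ> proj M)" by (rule range_eqI)
  qed
qed

lemma restrict_in_Alg_on:
  assumes A: "A \<in> Alg \<LL>" and K: "csubspace K" and inv: "A ` K \<subseteq> K"
    and comp: "compression K \<LL> = (\<lambda>E. E \<inter> K) ` \<LL>"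
  shows "restrict A K \<in> Alg_on K (compression K \<LL>)"
proof -
  have "restrict A K \<in> bounded_ops K"
    using A inv complex_vector.subspace_add[OF K] complex_vector.subspace_scale[OF K]
    by (auto simp: Alg_on_def bounded_ops_def clinear_on_def)
  moreover have "restrict A K ` (E \<inter> K) \<subseteq> E \<inter> K" if "E \<in> \<LL>" for E
    using A inv that by (auto simp: Alg_on_def)
  ultimately show ?thesis by (auto simp: Alg_on_def comp)
qed

lemma Alg_on_compression_bounded:
  assumes "A \<in> Alg_on K \<LL>" and K: "csubspace K" "closed K"
  shows "\<exists>a. \<forall>h. norm (A (proj K h)) \<le> a * norm h"
proof -
  obtain c where c: "\<And>x. x \<in> K \<Longrightarrow> norm (A x) \<le> c * norm x"
    using assms(1) unfolding Alg_on_def bounded_ops_def by blast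
  have "norm (A (proj K h)) \<le> \<bar>c\<bar> * norm h" for h
  proof -
    have "norm (A (proj K h)) \<le> c * norm (proj K h)" using c proj_in[OF K] .
    also have "\<dots> \<le> \<bar>c\<bar> * norm (proj K h)" by (intro mult_right_mono) auto
    also have "\<dots> \<le> \<bar>c\<bar> * norm h" by (intro mult_left_mono norm_proj_le K) auto
    finally show ?thesis .
  qed
  then show ?thesis by blast
qed

lemma orthogonal_decomposition_proj_sum:
  assumes dec: "orthogonal_decomposition K1 K2 K3"
    and K: "csubspace K1" "csubspace K2" "csubspace K3"
  shows "h = proj K1 h + proj K2 h + proj K3 h"
proof -
  obtain x y z where h: "h = x + y + z" "x \<in> K1" "y \<in> K2" "z \<in> K3"
    using dec unfolding orthogonal_decomposition_def by meson
  have orth: "cinner a b = 0" "cinner b a = 0" if "a \<in> K1 \<and> b \<in> K2 \<or> a \<in> K1 \<and> b \<in> K3 \<or> a \<in> K2 \<and> b \<in> K3"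
    for a b
  proof -
    show "cinner a b = 0" using dec that unfolding orthogonal_decomposition_def by blast
    then show "cinner b a = 0" by (simp add: cinner_eq_0_commute)
  qed
  have "proj K1 h = x" "proj K2 h = y" "proj K3 h = z"
    using h orth by (auto intro!: proj_eqI K simp: perp_def cinner_add_left)
  then show ?thesis using h(1) by simp
qed

text \<open>A subspace that is invariant under the whole algebra is in particular invariant under the
  projections of the lattice, which belong to the algebra by commutativity. Hence these
  projections split along the given decomposition and every \<open>E\<close> is the sum of its intersections with
  the three summands.\<close>

lemma Alg_eq_direct_sum_ops:
  fixes \<LL> :: "'a::chilbert_space set set"
  assumes L: "subspace_lattice \<LL>" and comm: "commutative_lattice \<LL>"
    and dec: "orthogonal_decomposition K1 K2 K3"
    and sub: "\<And>K. K \<in> {K1, K2, K3} \<Longrightarrow> csubspace K \<and> closed K"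
    and inv: "\<And>K A. K \<in> {K1, K2, K3} \<Longrightarrow> A \<in> Alg \<LL> \<Longrightarrow> A ` K \<subseteq> K"
  shows "Alg \<LL> = direct_sum_ops K1 (Alg_on K1 (compression K1 \<LL>))
    K2 (Alg_on K2 (compression K2 \<LL>)) K3 (Alg_on K3 (compression K3 \<LL>))"
proof -
  have sub': "csubspace K" "closed K" if "K \<in> {K1, K2, K3}" for K
    using sub[OF that] by auto
  have proj_Alg: "proj E \<in> Alg \<LL>" if "E \<in> \<LL>" for E
    using proj_in_bounded_ops[OF subspace_latticeD[OF L that]]
      commutative_lattice_proj_image[OF L comm that] by (simp add: Alg_on_def)
  have comp: "compression K \<LL> = (\<lambda>E. E \<inter> K) ` \<LL>" if "K \<in> {K1, K2, K3}" for K
    unfolding compression_def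
    by (intro image_cong refl range_compression sub'[OF that] subspace_latticeD[OF L]
        inv[OF that] proj_Alg)
  have projE: "proj K h \<in> E" if "K \<in> {K1, K2, K3}" "E \<in> \<LL>" "h \<in> E" for K E h
    using proj_image_subset_commute[OF subspace_latticeD[OF L that(2)] sub'[OF that(1)]]
      inv[OF that(1) proj_Alg[OF that(2)]] that(3) by blast
  have sum: "h = proj K1 h + proj K2 h + proj K3 h" for h
    by (rule orthogonal_decomposition_proj_sum[OF dec]) (simp_all add: sub')
  have pin: "proj K h \<in> K" if "K \<in> {K1, K2, K3}" for K h
    using proj_in[OF sub'[OF that]] .
  show ?thesis
  proof
    show "Alg \<LL> \<subseteq> direct_sum_ops K1 (Alg_on K1 (compression K1 \<LL>))
        K2 (Alg_on K2 (compression K2 \<LL>)) K3 (Alg_on K3 (compression K3 \<LL>))"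
    proof
      fix A assume A: "A \<in> Alg \<LL>"
      have add: "A (x + y) = A x + A y" for x y
        using A by (auto simp: Alg_on_def bounded_ops_def clinear_on_def)
      have "A h = restrict A K1 (proj K1 h) + restrict A K2 (proj K2 h) + restrict A K3 (proj K3 h)"
        for h
        using arg_cong[OF sum[of h], of A] pin by (simp add: add)
      then have "A = (\<lambda>h. restrict A K1 (proj K1 h) + restrict A K2 (proj K2 h)
          + restrict A K3 (proj K3 h))" by (rule ext)
      moreover have "restrict A K \<in> Alg_on K (compression K \<LL>)" if "K \<in> {K1, K2, K3}" for K
        by (rule restrict_in_Alg_on[OF A sub'(1)[OF that] inv[OF that A] comp[OF that]])
      ultimately show "A \<in> direct_sum_ops K1 (Alg_on K1 (compression K1 \<LL>))
          K2 (Alg_on K2 (compression K2 \<LL>)) K3 (Alg_on K3 (compression K3 \<LL>))"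
        unfolding direct_sum_ops_def by blast
    qed
    show "direct_sum_ops K1 (Alg_on K1 (compression K1 \<LL>))
        K2 (Alg_on K2 (compression K2 \<LL>)) K3 (Alg_on K3 (compression K3 \<LL>)) \<subseteq> Alg \<LL>"
    proof
      fix T assume "T \<in> direct_sum_ops K1 (Alg_on K1 (compression K1 \<LL>))
        K2 (Alg_on K2 (compression K2 \<LL>)) K3 (Alg_on K3 (compression K3 \<LL>))"
      then obtain A B C where T: "T = (\<lambda>h. A (proj K1 h) + B (proj K2 h) + C (proj K3 h))"
        and ABC: "A \<in> Alg_on K1 (compression K1 \<LL>)" "B \<in> Alg_on K2 (compression K2 \<LL>)"
          "C \<in> Alg_on K3 (compression K3 \<LL>)"
        unfolding direct_sum_ops_def by blast
      have lin: "F (proj K (x + y)) = F (proj K x) + F (proj K y)"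
        "F (proj K (c *\<^sub>C x)) = c *\<^sub>C F (proj K x)"
        if K: "K \<in> {K1, K2, K3}" and F: "F \<in> Alg_on K (compression K \<LL>)" for F K x y c
        using F pin[OF K] unfolding Alg_on_def bounded_ops_def clinear_on_def
        by (auto simp: proj_add[OF sub'[OF K]] proj_scaleC[OF sub'[OF K]])
      have mapE: "F (proj K h) \<in> E"
        if K: "K \<in> {K1, K2, K3}" and F: "F \<in> Alg_on K (compression K \<LL>)"
          and E: "E \<in> \<LL>" "h \<in> E" for F K E h
      proof -
        have "proj K h \<in> E \<inter> K" using projE[OF K E] pin[OF K] by blast
        moreover have "F ` (E \<inter> K) \<subseteq> E \<inter> K" using F E(1) by (auto simp: Alg_on_def comp[OF K])
        ultimately show ?thesis by blast
      qed
      have "clinear_on UNIV T"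
        using lin(1)[OF _ ABC(1)] lin(1)[OF _ ABC(2)] lin(1)[OF _ ABC(3)]
          lin(2)[OF _ ABC(1)] lin(2)[OF _ ABC(2)] lin(2)[OF _ ABC(3)]
        by (simp add: clinear_on_def T scaleC_add_right)
      moreover obtain a b c where "\<And>h. norm (A (proj K1 h)) \<le> a * norm h"
        "\<And>h. norm (B (proj K2 h)) \<le> b * norm h" "\<And>h. norm (C (proj K3 h)) \<le> c * norm h"
        using Alg_on_compression_bounded[OF ABC(1)] Alg_on_compression_bounded[OF ABC(2)]
          Alg_on_compression_bounded[OF ABC(3)] sub' by (metis insertCI)
      then have "norm (T h) \<le> (a + b + c) * norm h" for h
        unfolding T distrib_right by (intro norm_triangle_mono)
      ultimately have "T \<in> bounded_ops UNIV"
        by (auto simp: bounded_ops_def PiE_UNIV_domain)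
      moreover have "T h \<in> E" if E: "E \<in> \<LL>" "h \<in> E" for E h
        unfolding T
        by (intro complex_vector.subspace_add subspace_latticeD[OF L E(1)]
            mapE[OF _ ABC(1) E] mapE[OF _ ABC(2) E] mapE[OF _ ABC(3) E]) simp_all
      ultimately show "T \<in> Alg \<LL>" by (auto simp: Alg_on_def)
    qed
  qed
qed


section \<open>The three summands\<close>

text \<open>The complement is invariant because the complement of each isolated element belongs to the
  lattice.\<close>

lemma M_i_invariant:
  assumes "A \<in> Alg \<LL>"
  shows "A ` M_i \<LL> \<subseteq> M_i \<LL>" and "A ` perp (M_i \<LL>) \<subseteq> perp (M_i \<LL>)"
proof -
  have A: "A \<in> bounded_ops UNIV" "\<And>E. E \<in> \<LL> \<Longrightarrow> A ` E \<subseteq> E"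
    using assms by (auto simp: Alg_on_def)
  show "A ` M_i \<LL> \<subseteq> M_i \<LL>"
    unfolding M_i_def by (rule image_join_subset[OF A(1)]) (simp add: A(2) isolated_def)
  show "A ` perp (M_i \<LL>) \<subseteq> perp (M_i \<LL>)"
  proof safe
    fix y assume y: "y \<in> perp (M_i \<LL>)"
    have "E \<subseteq> perp {A y}" if E: "isolated \<LL> E" for E
    proof -
      have "E \<subseteq> M_i \<LL>" unfolding M_i_def using E by (simp add: join_upper)
      then have "y \<in> perp E" using y by (auto simp: perp_def)
      then have "A y \<in> perp E" using A(2)[of "perp E"] E by (auto simp: isolated_def)
      then show ?thesis by (subst subset_perp_commute) simp
    qed
    then have "M_i \<LL> \<subseteq> perp {A y}"
      unfolding M_i_def by (intro join_least closed_csubspace_perp) blast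
    then show "A y \<in> perp (M_i \<LL>)" by (subst (asm) subset_perp_commute) simp
  qed
qed

lemma join_minus_M_i_invariant:
  assumes A: "A \<in> Alg \<LL>" and "\<S> \<subseteq> \<LL>"
  shows "A ` ominus (join \<S>) (M_i \<LL>) \<subseteq> ominus (join \<S>) (M_i \<LL>)"
proof -
  have "A ` join \<S> \<subseteq> join \<S>"
    using A \<open>\<S> \<subseteq> \<LL>\<close> by (intro image_join_subset) (auto simp: Alg_on_def)
  then show ?thesis using M_i_invariant(2)[OF A] unfolding ominus_def by blast
qed

lemma closed_csubspace_ominus_join:
  "csubspace (ominus (join \<S>) K)" "closed (ominus (join \<S>) K)"
  unfolding ominus_def
  by (auto intro!: complex_vector.subspace_inter closed_Int closed_csubspace_join closed_csubspace_perp)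

text \<open>Let \<open>P\<close> be the projection onto the complement of \<open>M_i\<close>; it leaves the elements of the lattice
  invariant. For a consistent \<open>N\<close> and a twisted \<open>M\<close> the subspaces \<open>P N\<close> and \<open>P M\<close> are orthogonal because
  \<open>N \<inter> M\<close> is contained in \<open>M_i\<close>. Together \<open>P N\<close> and \<open>P M\<close> for all such \<open>N\<close> and \<open>M\<close> span the complement
  because the consistent and the twisted elements generate the whole space.\<close>

lemma orthogonal_decomposition_M:
  fixes \<LL> :: "'a::chilbert_space set set"
  assumes L: "subspace_lattice \<LL>" and comm: "commutative_lattice \<LL>"
    and cd: "completely_distributive \<LL>" and \<Phi>: "rank_preserving_map \<LL> \<Phi>"
  shows "orthogonal_decomposition (M_i \<LL>) (M_c \<LL> \<Phi>) (M_t \<LL> \<Phi>)"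
proof -
  define P where "P = proj (perp (M_i \<LL>))"
  note subP = closed_csubspace_perp[of "M_i \<LL>"]
  have subMi: "csubspace (M_i \<LL>)" "closed (M_i \<LL>)"
    unfolding M_i_def by (rule closed_csubspace_join)+
  have subMc: "csubspace (M_c \<LL> \<Phi>)" "closed (M_c \<LL> \<Phi>)"
    unfolding M_c_def by (rule closed_csubspace_ominus_join)+
  have subMt: "csubspace (M_t \<LL> \<Phi>)" "closed (M_t \<LL> \<Phi>)"
    unfolding M_t_def by (rule closed_csubspace_ominus_join)+
  have proj_Alg: "proj E \<in> Alg \<LL>" if "E \<in> \<LL>" for E
    using proj_in_bounded_ops[OF subspace_latticeD[OF L that]]
      commutative_lattice_proj_image[OF L comm that] by (simp add: Alg_on_def)
  have PE: "P x \<in> E" if "E \<in> \<LL>" "x \<in> E" for E x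
    using proj_image_subset_commute[OF subspace_latticeD[OF L that(1)] subP
        M_i_invariant(2)[OF proj_Alg[OF that(1)]]] that(2) unfolding P_def by blast
  have Pperp: "P x \<in> perp (M_i \<LL>)" for x
    unfolding P_def by (rule proj_in[OF subP])
  have Pid: "P x = x" if "x \<in> perp (M_i \<LL>)" for x
    unfolding P_def by (rule proj_id[OF subP(1) that])
  have Padj: "cinner (P x) y = cinner x (P y)" for x y
    unfolding P_def by (rule cinner_proj_commute[OF subP])
  have orth0: "cinner (P a) (P b) = 0"
    if N: "consistent \<LL> \<Phi> N" "a \<in> N" and M: "twisted \<LL> \<Phi> M" "b \<in> M" for N M a b
  proof -
    have N_in: "N \<in> \<LL>" and M_in: "M \<in> \<LL>" using N M by (auto simp: consistent_def twisted_def)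
    have "proj N (P b) \<in> N" using proj_in[OF subspace_latticeD[OF L N_in]] .
    moreover have "proj N (P b) \<in> M"
      using commutative_lattice_proj_image[OF L comm N_in M_in] PE[OF M_in M(2)] by blast
    ultimately have "proj N (P b) \<in> M_i \<LL>"
      using consistent_meet_twisted[OF L comm cd \<Phi> N(1) M(1)] by blast
    then have "cinner (P a) (proj N (P b)) = 0" using Pperp[of a] by (auto simp: perp_def)
    then have "cinner (proj N (P a)) (P b) = 0"
      using cinner_proj_commute[OF subspace_latticeD[OF L N_in]] by metis
    then show ?thesis
      using proj_id[OF subspace_latticeD(1)[OF L N_in] PE[OF N_in N(2)]] by simp
  qed
  have ct: "cinner x y = 0" if x: "x \<in> M_c \<LL> \<Phi>" and y: "y \<in> M_t \<LL> \<Phi>" for x y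
  proof -
    have x': "x \<in> join {E. consistent \<LL> \<Phi> E}" "P x = x"
      using x Pid by (auto simp: M_c_def ominus_def)
    have y': "y \<in> join {E. twisted \<LL> \<Phi> E}" using y by (auto simp: M_t_def ominus_def)
    have "cinner x b = 0" if M: "twisted \<LL> \<Phi> M" "b \<in> M" for M b
    proof -
      have "join {E. consistent \<LL> \<Phi> E} \<subseteq> perp {P b}"
      proof (rule join_least[OF closed_csubspace_perp])
        fix N assume "N \<in> {E. consistent \<LL> \<Phi> E}"
        then have "cinner a (P b) = 0" if "a \<in> N" for a
          using orth0[of N a M b] M that Padj[of a "P b"] Pid[OF Pperp] by simp
        then show "N \<subseteq> perp {P b}" by (auto simp: perp_def)
      qed
      then have "cinner x (P b) = 0" using x'(1) by (auto simp: perp_def)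
      then show ?thesis using Padj[of x b] x'(2) by simp
    qed
    then have "M \<subseteq> perp {x}" if "M \<in> {E. twisted \<LL> \<Phi> E}" for M
      using that by (auto simp: perp_def cinner_eq_0_commute)
    then have "join {E. twisted \<LL> \<Phi> E} \<subseteq> perp {x}"
      by (rule join_least[OF closed_csubspace_perp])
    then have "cinner y x = 0" using y' by (auto simp: perp_def)
    then show ?thesis by (simp add: cinner_eq_0_commute)
  qed
  have ic: "cinner x y = 0" if "x \<in> M_i \<LL>" "y \<in> M_c \<LL> \<Phi> \<union> M_t \<LL> \<Phi>" for x y
  proof -
    have "cinner y x = 0" using that by (auto simp: M_c_def M_t_def ominus_def perp_def)
    then show ?thesis by (simp add: cinner_eq_0_commute)
  qed
  have "\<exists>x\<in>M_i \<LL>. \<exists>y\<in>M_c \<LL> \<Phi>. \<exists>z\<in>M_t \<LL> \<Phi>. h = x + y + z" for h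
  proof -
    define x y z where "x = proj (M_i \<LL>) h" and "y = proj (M_c \<LL> \<Phi>) h"
      and "z = proj (M_t \<LL> \<Phi>) h"
    define r where "r = h - x - y - z"
    have xyz: "x \<in> M_i \<LL>" "y \<in> M_c \<LL> \<Phi>" "z \<in> M_t \<LL> \<Phi>"
      unfolding x_def y_def z_def by (intro proj_in subMi subMc subMt)+
    have hx: "cinner (h - x) w = 0" if "w \<in> M_i \<LL>" for w
      using diff_proj_in_perp[OF subMi, of h] that by (auto simp: x_def perp_def)
    have hy: "cinner (h - y) w = 0" if "w \<in> M_c \<LL> \<Phi>" for w
      using diff_proj_in_perp[OF subMc, of h] that by (auto simp: y_def perp_def)
    have hz: "cinner (h - z) w = 0" if "w \<in> M_t \<LL> \<Phi>" for w
      using diff_proj_in_perp[OF subMt, of h] that by (auto simp: z_def perp_def)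
    have "cinner y w = 0" "cinner z w = 0" if "w \<in> M_i \<LL>" for w
      using ic[of w y] ic[of w z] xyz that by (auto simp: cinner_eq_0_commute)
    then have r_i: "r \<in> perp (M_i \<LL>)"
      unfolding perp_def r_def using hx by (auto simp: cinner_diff_left)
    have r_c: "cinner r w = 0" if "w \<in> M_c \<LL> \<Phi>" for w
    proof -
      have "cinner x w = 0" "cinner z w = 0"
        using ic[of x w] ct[of w z] xyz that by (auto simp: cinner_eq_0_commute[of z])
      then show ?thesis using hy[OF that] by (simp add: r_def cinner_diff_left)
    qed
    have r_t: "cinner r w = 0" if "w \<in> M_t \<LL> \<Phi>" for w
    proof -
      have "cinner x w = 0" "cinner y w = 0" using ic[of x w] ct[of y w] xyz that by auto
      then show ?thesis using hz[OF that] by (simp add: r_def cinner_diff_left)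
    qed
    \<comment> \<open>the remainder is orthogonal to all three summands; being fixed by \<open>P\<close>, it is orthogonal to
      every generating element of the lattice\<close>
    have "UNIV \<subseteq> perp {r}"
    proof (rule lattice_element_subsetI[OF L cd _ closed_csubspace_perp])
      show "UNIV \<in> \<LL>" using L by (simp add: subspace_lattice_def)
      fix K assume K: "K \<in> \<LL>" "K \<noteq> {0}" "lower \<LL> K \<noteq> UNIV"
      have "cinner r w = 0" if w: "w \<in> K" for w
      proof -
        have Pw: "P w \<in> K" using PE[OF K(1) w] .
        from consistent_or_twisted[OF L \<Phi> K] have "cinner r (P w) = 0"
        proof
          assume "consistent \<LL> \<Phi> K"
          then have "K \<subseteq> join {E. consistent \<LL> \<Phi> E}" by (intro join_upper) simp
          then have "P w \<in> join {E. consistent \<LL> \<Phi> E}" using Pw by blast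
          then show ?thesis using r_c Pperp by (simp add: M_c_def ominus_def)
        next
          assume "twisted \<LL> \<Phi> K"
          then have "K \<subseteq> join {E. twisted \<LL> \<Phi> E}" by (intro join_upper) simp
          then have "P w \<in> join {E. twisted \<LL> \<Phi> E}" using Pw by blast
          then show ?thesis using r_t Pperp by (simp add: M_t_def ominus_def)
        qed
        then show ?thesis using Padj[of r w] Pid[OF r_i] by simp
      qed
      then show "K \<subseteq> perp {r}" by (auto simp: perp_def cinner_eq_0_commute)
    qed
    then have "r = 0" using in_perp_both_eq_0[of r "{r}"] by blast
    then have "h = x + y + z" by (simp add: r_def algebra_simps)
    then show ?thesis using xyz by blast
  qed
  then show ?thesis
    unfolding orthogonal_decomposition_def using ct ic by blast
qed

theorem theorem2p11:
  fixes \<LL> :: "'a::chilbert_space set set"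
    and \<Phi> :: "('a \<Rightarrow> 'a) \<Rightarrow> ('a \<Rightarrow> 'a)"
  assumes "separable_space (euclidean :: 'a topology)"
    and "subspace_lattice \<LL>"
    and "commutative_lattice \<LL>"
    and "completely_distributive \<LL>"
    and "rank_preserving_map \<LL> \<Phi>"
    and "weakly_continuous \<LL> \<Phi>"
  shows "orthogonal_decomposition (M_i \<LL>) (M_c \<LL> \<Phi>) (M_t \<LL> \<Phi>) \<and>
    Alg \<LL> =
      direct_sum_ops
        (M_i \<LL>) (Alg_on (M_i \<LL>) (compression (M_i \<LL>) \<LL>))
        (M_c \<LL> \<Phi>) (Alg_on (M_c \<LL> \<Phi>) (compression (M_c \<LL> \<Phi>) \<LL>))
        (M_t \<LL> \<Phi>) (Alg_on (M_t \<LL> \<Phi>) (compression (M_t \<LL> \<Phi>) \<LL>))"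
proof
  show dec: "orthogonal_decomposition (M_i \<LL>) (M_c \<LL> \<Phi>) (M_t \<LL> \<Phi>)"
    by (rule orthogonal_decomposition_M[OF assms(2-5)])
  show "Alg \<LL> =
      direct_sum_ops
        (M_i \<LL>) (Alg_on (M_i \<LL>) (compression (M_i \<LL>) \<LL>))
        (M_c \<LL> \<Phi>) (Alg_on (M_c \<LL> \<Phi>) (compression (M_c \<LL> \<Phi>) \<LL>))
        (M_t \<LL> \<Phi>) (Alg_on (M_t \<LL> \<Phi>) (compression (M_t \<LL> \<Phi>) \<LL>))"
  proof (rule Alg_eq_direct_sum_ops[OF assms(2,3) dec])
    fix K assume K: "K \<in> {M_i \<LL>, M_c \<LL> \<Phi>, M_t \<LL> \<Phi>}"
    then show "csubspace K \<and> closed K"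
      using closed_csubspace_join closed_csubspace_ominus_join
      unfolding M_i_def M_c_def M_t_def by blast
    fix A assume A: "A \<in> Alg \<LL>"
    have "{E. consistent \<LL> \<Phi> E} \<subseteq> \<LL>" "{E. twisted \<LL> \<Phi> E} \<subseteq> \<LL>"
      by (auto simp: consistent_def twisted_def)
    then show "A ` K \<subseteq> K"
      using K M_i_invariant(1)[OF A] join_minus_M_i_invariant[OF A]
      unfolding M_c_def M_t_def by blast
  qed
qed

end
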